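(* Let $G$ be a finitely generated group with Property (QT). Then $G$ has a proper uniformly Lipschitz affine action on $\ell^1$ with quasi-isometrically embedded orbits.
   Context: A map $g:X\to Y$ between metric spaces is a quasi-isometric embedding if there is $A\geq 1$ with $\frac1A d_X(x_1,x_2)-A\leq d_Y(g(x_1),g(x_2))\leq A d_X(x_1,x_2)+A$ for all $x_1,x_2\in X$. It is a quasi-isometry if moreover there is $C>0$ such that every ball of radius $C$ in $Y$ intersects $g(X)$. A metric space is a quasi-tree if it is quasi-isometric to a simplicial tree (a connected graph without cycles, with its edge-path distance). A finite product $X_1\times\cdots\times X_N$ of metric spaces $(X_i,d_i)$ is endowed with the metric $d(x,y)=\sum_{i=1}^N d_i(x_i,y_i)$. A finitely generated group $G$, endowed with the word metric of a finite generating set, has Property (QT) if it admits an isometric action on a finite product $X$ of quasi-trees such that the orbit maps $G\to X$, $s\mapsto s\cdot o$ ($o\in X$), are quasi-isometric embeddings. An affine action of $G$ on a Banach space $E$ is an action of the form $\sigma(s)v=\pi(s)v+b(s)$, where $\pi:G\to\operatorname{GL}(E)$ is a homomorphism into the group of bounded invertible operators on $E$ and $b:G\to E$ satisfies $b(st)=\pi(s)b(t)+b(s)$ for all $s,t\in G$. It is uniformly Lipschitz if $\sup_{s\in G}\|\pi(s)\|<\infty$. It is proper if for every $v\in E$ (equivalently, some $v$) and every $r>0$ the set $\{s\in G : \|\sigma(s)v-v\|\leq r\}$ is finite. It has quasi-isometrically embedded orbits if the orbit maps $G\to E$, $s\mapsto\sigma(s)v$ ($v\in E$), are quasi-isometric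 embeddings, $G$ being endowed with a word metric. $\ell^1$ is the Banach space of absolutely summable sequences. *)

theory Defs
  imports "HOL-Analysis.Analysis" "HOL-Algebra.Group_Action" "HOL-Algebra.Generated_Groups"
begin

section \<open>Quasi-isometries\<close>

text \<open>A metric space is given by a carrier and a distance function, as in the locale
  \<^locale>\<open>Metric_space\<close>.\<close>

definition qi_embedding ::
    "'a set \<Rightarrow> ('a \<Rightarrow> 'a \<Rightarrow> real) \<Rightarrow> ('b \<Rightarrow> 'b \<Rightarrow> real) \<Rightarrow> ('a \<Rightarrow> 'b) \<Rightarrow> bool" where
  "qi_embedding X dX dY g \<longleftrightarrow>
     (\<exists>A\<ge>1. \<forall>x1\<in>X. \<forall>x2\<in>X.
        (1 / A) * dX x1 x2 - A \<le> dY (g x1) (g x2) \<and>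
        dY (g x1) (g x2) \<le> A * dX x1 x2 + A)"

definition quasi_isometry ::
    "'a set \<Rightarrow> ('a \<Rightarrow> 'a \<Rightarrow> real) \<Rightarrow> 'b set \<Rightarrow> ('b \<Rightarrow> 'b \<Rightarrow> real) \<Rightarrow> ('a \<Rightarrow> 'b) \<Rightarrow> bool" where
  "quasi_isometry X dX Y dY g \<longleftrightarrow>
     g \<in> X \<rightarrow> Y \<and> qi_embedding X dX dY g \<and>
     (\<exists>C>0. \<forall>y\<in>Y. Metric_space.mball Y dY y C \<inter> g ` X \<noteq> {})"

section \<open>Simplicial trees and quasi-trees\<close>

definition simple_graph :: "'v set \<Rightarrow> ('v \<Rightarrow> 'v \<Rightarrow> bool) \<Rightarrow> bool" where
  "simple_graph V E \<longleftrightarrow> (\<forall>x y. E x y \<longrightarrow> x \<in> V \<and> y \<in> V \<and> x \<noteq> y \<and> E y x)"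

text \<open>A walk is given by its list of vertices, so it has one edge less than its length.\<close>

definition walk_between ::
    "'v set \<Rightarrow> ('v \<Rightarrow> 'v \<Rightarrow> bool) \<Rightarrow> 'v \<Rightarrow> 'v list \<Rightarrow> 'v \<Rightarrow> bool" where
  "walk_between V E u p v \<longleftrightarrow>
     p \<noteq> [] \<and> set p \<subseteq> V \<and> hd p = u \<and> last p = v \<and> successively E p"

definition graph_connected :: "'v set \<Rightarrow> ('v \<Rightarrow> 'v \<Rightarrow> bool) \<Rightarrow> bool" where
  "graph_connected V E \<longleftrightarrow> V \<noteq> {} \<and> (\<forall>u\<in>V. \<forall>v\<in>V. \<exists>p. walk_between V E u p v)"

definition graph_cycle :: "('v \<Rightarrow> 'v \<Rightarrow> bool) \<Rightarrow> 'v list \<Rightarrow> bool" where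
  "graph_cycle E p \<longleftrightarrow>
     length p \<ge> 3 \<and> distinct p \<and> successively E p \<and> E (last p) (hd p)"

definition simplicial_tree :: "'v set \<Rightarrow> ('v \<Rightarrow> 'v \<Rightarrow> bool) \<Rightarrow> bool" where
  "simplicial_tree V E \<longleftrightarrow>
     simple_graph V E \<and> graph_connected V E \<and> (\<nexists>p. graph_cycle E p)"

definition path_dist :: "'v set \<Rightarrow> ('v \<Rightarrow> 'v \<Rightarrow> bool) \<Rightarrow> 'v \<Rightarrow> 'v \<Rightarrow> real" where
  "path_dist V E u v = real (LEAST n. \<exists>p. walk_between V E u p v \<and> length p = Suc n)"

text \<open>A formula cannot quantify over types, so the type of the vertices of the comparison tree is a
  parameter. Trees are nonempty, hence so are quasi-trees.\<close>

definition quasi_tree :: "'v itself \<Rightarrow> 'x set \<Rightarrow> ('x \<Rightarrow> 'x \<Rightarrow> real) \<Rightarrow> bool" where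
  "quasi_tree _ X d \<longleftrightarrow>
     Metric_space X d \<and>
     (\<exists>(V :: 'v set) E g. simplicial_tree V E \<and> quasi_isometry X d V (path_dist V E) g)"

section \<open>Word metrics\<close>

definition finite_generating_set :: "('g, 'm) monoid_scheme \<Rightarrow> 'g set \<Rightarrow> bool" where
  "finite_generating_set G S \<longleftrightarrow> finite S \<and> S \<subseteq> carrier G \<and> generate G S = carrier G"

definition finitely_generated :: "('g, 'm) monoid_scheme \<Rightarrow> bool" where
  "finitely_generated G \<longleftrightarrow> (\<exists>S. finite_generating_set G S)"

definition word_length :: "('g, 'm) monoid_scheme \<Rightarrow> 'g set \<Rightarrow> 'g \<Rightarrow> nat" where
  "word_length G S g =
     (LEAST n. \<exists>w. length w = n \<and> set w \<subseteq> S \<union> (\<lambda>s. inv\<^bsub>G\<^esub> s) ` S \<and>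
        foldr (\<lambda>x y. x \<otimes>\<^bsub>G\<^esub> y) w \<one>\<^bsub>G\<^esub> = g)"

definition word_dist :: "('g, 'm) monoid_scheme \<Rightarrow> 'g set \<Rightarrow> 'g \<Rightarrow> 'g \<Rightarrow> real" where
  "word_dist G S g h = real (word_length G S (inv\<^bsub>G\<^esub> g \<otimes>\<^bsub>G\<^esub> h))"

section \<open>Property (QT)\<close>

text \<open>Points of a product indexed by \<open>{1..N}\<close> are extensional functions in
  \<^const>\<open>PiE\<close>. A single type for the points of all factors loses no generality, since the
  types of finitely many factors embed into their disjoint sum; the same holds for the trees.\<close>

definition prod_dist ::
    "nat \<Rightarrow> (nat \<Rightarrow> 'x \<Rightarrow> 'x \<Rightarrow> real) \<Rightarrow> (nat \<Rightarrow> 'x) \<Rightarrow> (nat \<Rightarrow> 'x) \<Rightarrow> real" where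
  "prod_dist N d x y = (\<Sum>i=1..N. d i (x i) (y i))"

definition isometric_action ::
    "('g, 'm) monoid_scheme \<Rightarrow> 'p set \<Rightarrow> ('p \<Rightarrow> 'p \<Rightarrow> real) \<Rightarrow> ('g \<Rightarrow> 'p \<Rightarrow> 'p) \<Rightarrow> bool" where
  "isometric_action G P d \<phi> \<longleftrightarrow>
     group_action G P \<phi> \<and>
     (\<forall>s\<in>carrier G. \<forall>x\<in>P. \<forall>y\<in>P. d (\<phi> s x) (\<phi> s y) = d x y)"

definition property_QT ::
    "'x itself \<Rightarrow> 'v itself \<Rightarrow> ('g, 'm) monoid_scheme \<Rightarrow> bool" where
  "property_QT _ _ G \<longleftrightarrow>
     (\<exists>S N (X :: nat \<Rightarrow> 'x set) d \<phi>.
        finite_generating_set G S \<and> N \<ge> 1 \<and>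
        (\<forall>i\<in>{1..N}. quasi_tree TYPE('v) (X i) (d i)) \<and>
        isometric_action G (PiE {1..N} X) (prod_dist N d) \<phi> \<and>
        (\<forall>z\<in>PiE {1..N} X.
           qi_embedding (carrier G) (word_dist G S) (prod_dist N d) (\<lambda>s. \<phi> s z)))"

section \<open>Affine actions\<close>

definition bounded_operators :: "('e::real_normed_vector \<Rightarrow>\<^sub>L 'e) monoid" where
  "bounded_operators = \<lparr>carrier = UNIV, mult = (o\<^sub>L), one = id_blinfun\<rparr>"

definition GL :: "('e::real_normed_vector \<Rightarrow>\<^sub>L 'e) monoid" where
  "GL = units_of bounded_operators"

lemma group_GL: "group (GL :: ('e::real_normed_vector \<Rightarrow>\<^sub>L 'e) monoid)"
proof -
  have "Group.monoid (bounded_operators :: ('e \<Rightarrow>\<^sub>L 'e) monoid)"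
    by unfold_locales (auto simp: bounded_operators_def blinfun_eqI)
  then show ?thesis
    unfolding GL_def by (rule monoid.units_group)
qed

lemma carrier_GL: "carrier GL = {T. \<exists>T'. T' o\<^sub>L T = id_blinfun \<and> T o\<^sub>L T' = id_blinfun}"
  by (auto simp: GL_def units_of_def Units_def bounded_operators_def)

text \<open>The affine action with linear part \<open>\<pi>\<close> and cocycle \<open>b\<close>.\<close>

definition affine_map ::
    "('g \<Rightarrow> 'e::real_normed_vector \<Rightarrow>\<^sub>L 'e) \<Rightarrow> ('g \<Rightarrow> 'e) \<Rightarrow> 'g \<Rightarrow> 'e \<Rightarrow> 'e" where
  "affine_map \<pi> b s v = blinfun_apply (\<pi> s) v + b s"

definition affine_action ::
    "('g, 'm) monoid_scheme \<Rightarrow> ('g \<Rightarrow> 'e::banach \<Rightarrow>\<^sub>L 'e) \<Rightarrow> ('g \<Rightarrow> 'e) \<Rightarrow> bool" where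
  "affine_action G \<pi> b \<longleftrightarrow>
     \<pi> \<in> hom G GL \<and>
     (\<forall>s\<in>carrier G. \<forall>t\<in>carrier G. b (s \<otimes>\<^bsub>G\<^esub> t) = blinfun_apply (\<pi> s) (b t) + b s)"

definition uniformly_lipschitz ::
    "('g, 'm) monoid_scheme \<Rightarrow> ('g \<Rightarrow> 'e::real_normed_vector \<Rightarrow>\<^sub>L 'e) \<Rightarrow> bool" where
  "uniformly_lipschitz G \<pi> \<longleftrightarrow> bdd_above ((\<lambda>s. norm (\<pi> s)) ` carrier G)"

definition proper_action ::
    "('g, 'm) monoid_scheme \<Rightarrow> ('g \<Rightarrow> 'e::real_normed_vector \<Rightarrow> 'e) \<Rightarrow> bool" where
  "proper_action G \<sigma> \<longleftrightarrow> (\<forall>v. \<forall>r>0. finite {s \<in> carrier G. norm (\<sigma> s v - v) \<le> r})"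

definition qi_embedded_orbits ::
    "('g, 'm) monoid_scheme \<Rightarrow> ('g \<Rightarrow> 'e::real_normed_vector \<Rightarrow> 'e) \<Rightarrow> bool" where
  "qi_embedded_orbits G \<sigma> \<longleftrightarrow>
     (\<forall>S. finite_generating_set G S \<longrightarrow>
        (\<forall>v. qi_embedding (carrier G) (word_dist G S) dist (\<lambda>s. \<sigma> s v)))"

section \<open>The Banach space of absolutely summable real sequences\<close>

typedef ell1 = "{x :: nat \<Rightarrow> real. summable (\<lambda>n. \<bar>x n\<bar>)}"
  morphisms ell1_nth Abs_ell1
  by (rule exI[of _ "\<lambda>_. 0"]) simp

setup_lifting type_definition_ell1

lemma summable_ell1: "summable (\<lambda>n. \<bar>ell1_nth x n\<bar>)"
  using ell1_nth[of x] by simp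

lemma summable_abs_add:
  fixes x y :: "nat \<Rightarrow> real"
  assumes "summable (\<lambda>n. \<bar>x n\<bar>)" "summable (\<lambda>n. \<bar>y n\<bar>)"
  shows "summable (\<lambda>n. \<bar>x n + y n\<bar>)"
  by (rule summable_comparison_test'[OF summable_add[OF assms], of 0]) auto

instantiation ell1 :: real_normed_vector
begin

lift_definition zero_ell1 :: ell1 is "\<lambda>_. 0" by simp

lift_definition plus_ell1 :: "ell1 \<Rightarrow> ell1 \<Rightarrow> ell1" is "\<lambda>x y n. x n + y n"
  by (rule summable_abs_add)

lift_definition uminus_ell1 :: "ell1 \<Rightarrow> ell1" is "\<lambda>x n. - x n" by simp

lift_definition minus_ell1 :: "ell1 \<Rightarrow> ell1 \<Rightarrow> ell1" is "\<lambda>x y n. x n - y n"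
  subgoal for x y using summable_abs_add[of x "\<lambda>n. - y n"] by simp
  done

lift_definition scaleR_ell1 :: "real \<Rightarrow> ell1 \<Rightarrow> ell1" is "\<lambda>c x n. c * x n"
  by (simp add: abs_mult summable_mult)

lift_definition norm_ell1 :: "ell1 \<Rightarrow> real" is "\<lambda>x. \<Sum>n. \<bar>x n\<bar>" .

definition dist_ell1 :: "ell1 \<Rightarrow> ell1 \<Rightarrow> real" where
  "dist_ell1 x y = norm (x - y)"

definition sgn_ell1 :: "ell1 \<Rightarrow> ell1" where
  "sgn_ell1 x = inverse (norm x) *\<^sub>R x"

definition uniformity_ell1 :: "(ell1 \<times> ell1) filter" where
  "uniformity_ell1 = (INF e\<in>{0<..}. principal {(x, y). dist x y < e})"

definition open_ell1 :: "ell1 set \<Rightarrow> bool" where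
  "open_ell1 U \<longleftrightarrow> (\<forall>x\<in>U. eventually (\<lambda>(x', y). x' = x \<longrightarrow> y \<in> U) uniformity)"

instance
proof
  fix x y z :: ell1 and a c :: real
  show "dist x y = norm (x - y)" by (rule dist_ell1_def)
  show "sgn x = inverse (norm x) *\<^sub>R x" by (rule sgn_ell1_def)
  show "uniformity = (INF e\<in>{0<..}. principal {(x, y :: ell1). dist x y < e})"
    by (rule uniformity_ell1_def)
  show "open U \<longleftrightarrow> (\<forall>x\<in>U. eventually (\<lambda>(x', y). x' = x \<longrightarrow> y \<in> U) uniformity)"
    for U :: "ell1 set" by (rule open_ell1_def)
  show "x + y + z = x + (y + z)" by transfer (simp add: add.assoc)
  show "x + y = y + x" by transfer (simp add: add.commute)
  show "0 + x = x" by transfer simp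
  show "- x + x = 0" by transfer simp
  show "x - y = x + - y" by transfer simp
  show "a *\<^sub>R (x + y) = a *\<^sub>R x + a *\<^sub>R y" by transfer (simp add: distrib_left)
  show "(a + c) *\<^sub>R x = a *\<^sub>R x + c *\<^sub>R x" by transfer (simp add: distrib_right)
  show "a *\<^sub>R c *\<^sub>R x = (a * c) *\<^sub>R x" by transfer (simp add: mult.assoc)
  show "1 *\<^sub>R x = x" by transfer simp
  show "norm x = 0 \<longleftrightarrow> x = 0" by transfer (simp add: suminf_eq_zero_iff fun_eq_iff)
  show "norm (a *\<^sub>R x) = \<bar>a\<bar> * norm x" by transfer (simp add: abs_mult suminf_mult)
  show "norm (x + y) \<le> norm x + norm y"
  proof transfer
    fix x y :: "nat \<Rightarrow> real"
    assume *: "summable (\<lambda>n. \<bar>x n\<bar>)" "summable (\<lambda>n. \<bar>y n\<bar>)"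
    have "(\<Sum>n. \<bar>x n + y n\<bar>) \<le> (\<Sum>n. \<bar>x n\<bar> + \<bar>y n\<bar>)"
      by (intro suminf_le summable_abs_add summable_add *) auto
    then show "(\<Sum>n. \<bar>x n + y n\<bar>) \<le> (\<Sum>n. \<bar>x n\<bar>) + (\<Sum>n. \<bar>y n\<bar>)"
      using suminf_add[OF *] by simp
  qed
qed

end

lemma sum_abs_le_norm_ell1: "(\<Sum>k<K. \<bar>ell1_nth x k\<bar>) \<le> norm x"
  unfolding norm_ell1.rep_eq by (rule sum_le_suminf[OF summable_ell1]) auto

lemma abs_nth_le_norm_ell1: "\<bar>ell1_nth x k\<bar> \<le> norm x"
proof -
  have "\<bar>ell1_nth x k\<bar> \<le> (\<Sum>i<Suc k. \<bar>ell1_nth x i\<bar>)"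
    by (simp add: sum_nonneg)
  then show ?thesis using sum_abs_le_norm_ell1 order_trans by blast
qed

instance ell1 :: banach
proof
  fix X :: "nat \<Rightarrow> ell1"
  assume X: "Cauchy X"
  define f where "f n k = ell1_nth (X n) k" for n k
  have nth_diff: "ell1_nth (X m - X n) k = f m k - f n k" for m n k
    by (simp add: f_def minus_ell1.rep_eq)
  have "Cauchy (\<lambda>n. f n k)" for k
  proof (rule CauchyI)
    fix e :: real assume "e > 0"
    then obtain M where "\<forall>m\<ge>M. \<forall>n\<ge>M. norm (X m - X n) < e"
      using CauchyD[OF X] by blast
    then show "\<exists>M. \<forall>m\<ge>M. \<forall>n\<ge>M. norm (f m k - f n k) < e"
      using abs_nth_le_norm_ell1[of "X _ - X _" k] unfolding nth_diff real_norm_def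
      by (meson le_less_trans)
  qed
  then have "\<forall>k. \<exists>l. (\<lambda>n. f n k) \<longlonglongrightarrow> l"
    by (simp add: Cauchy_convergent_iff convergent_def)
  then obtain g where g: "\<And>k. (\<lambda>n. f n k) \<longlonglongrightarrow> g k"
    by metis
  have tail: "\<exists>M. \<forall>m\<ge>M. \<forall>K. (\<Sum>k<K. \<bar>f m k - g k\<bar>) \<le> e" if e: "e > 0" for e
  proof -
    obtain M where M: "\<And>m n. m \<ge> M \<Longrightarrow> n \<ge> M \<Longrightarrow> norm (X m - X n) < e"
      using CauchyD[OF X e] by blast
    have "(\<Sum>k<K. \<bar>f m k - g k\<bar>) \<le> e" if "m \<ge> M" for m K
    proof (rule tendsto_upperbound)
      show "(\<lambda>n. \<Sum>k<K. \<bar>f m k - f n k\<bar>) \<longlonglongrightarrow> (\<Sum>k<K. \<bar>f m k - g k\<bar>)"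
        by (intro tendsto_intros g)
      show "\<forall>\<^sub>F n in sequentially. (\<Sum>k<K. \<bar>f m k - f n k\<bar>) \<le> e"
        using eventually_ge_at_top[of M]
      proof eventually_elim
        case (elim n)
        then show ?case
          using sum_abs_le_norm_ell1[of "X m - X n" K] M[OF that elim] by (simp add: nth_diff)
      qed
    qed simp
    then show ?thesis by blast
  qed
  have diff_summable: "summable (\<lambda>k. \<bar>f m k - g k\<bar>)" if "\<forall>K. (\<Sum>k<K. \<bar>f m k - g k\<bar>) \<le> e" for m e
    using that by (intro summableI_nonneg_bounded[where x = e]) auto
  obtain M where "\<forall>K. (\<Sum>k<K. \<bar>f M k - g k\<bar>) \<le> 1"
    using tail[of 1] by auto
  then have "summable (\<lambda>k. \<bar>f M k + - (f M k - g k)\<bar>)"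
    using diff_summable summable_ell1[of "X M"]
    by (intro summable_abs_add) (auto simp: f_def abs_minus_commute)
  then have "summable (\<lambda>k. \<bar>g k\<bar>)" by simp
  then have nth_Abs: "ell1_nth (Abs_ell1 g) = g"
    by (simp add: Abs_ell1_inverse)
  have "X \<longlonglongrightarrow> Abs_ell1 g"
  proof (rule LIMSEQ_I)
    fix r :: real assume "r > 0"
    then obtain M where M: "\<forall>m\<ge>M. \<forall>K. (\<Sum>k<K. \<bar>f m k - g k\<bar>) \<le> r / 2"
      using tail[of "r / 2"] by auto
    have "norm (X m - Abs_ell1 g) < r" if "m \<ge> M" for m
    proof -
      have *: "\<forall>K. (\<Sum>k<K. \<bar>f m k - g k\<bar>) \<le> r / 2" using M that by blast
      have "norm (X m - Abs_ell1 g) = (\<Sum>k. \<bar>f m k - g k\<bar>)"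
        by (simp add: norm_ell1.rep_eq minus_ell1.rep_eq nth_Abs f_def)
      also have "\<dots> \<le> r / 2"
        using * diff_summable[OF *] by (intro suminf_le_const) auto
      finally show ?thesis using \<open>r > 0\<close> by simp
    qed
    then show "\<exists>M. \<forall>m\<ge>M. norm (X m - Abs_ell1 g) < r" by blast
  qed
  then show "convergent X" by (auto simp: convergent_def)
qed

end

theory Submission
  imports Defs
begin

text \<open>An isometry of a finite product of metric spaces maps lines parallel to a factor to convex sets for
  the sum metric, and convex sets of a product are boxes. A box in which two coordinates are
  unbounded is not a quasi-tree, so an isometry permutes the unbounded factors up to a bounded
  error. Hence the orbit gives, for each unbounded factor, a pseudometric on \<open>G\<close>, and these are
  permuted by the group up to a bounded error. Being coarsely connected subsets of quasi-trees, the
  orbits carry tree structures, on the vertex set \<open>G\<close>, whose path metrics are quasi-isometric to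
  these pseudometrics; vertices being at distance at least 1, bounded errors become bounded factors.
  The free Banach space over the vertices of a tree is the \<open>\<ell>\<^sup>1\<close>-space over its edges. The group
  acts on the sum of these spaces with uniformly bounded linear part, and the cocycle is the formal
  difference \<open>s - 1\<close>, whose norm is the sum of the distances in the trees.\<close>

section \<open>Simplicial trees with a root\<close>

text \<open>The isometries act on the product, not on its factors, so a group element does not act
  on a single coordinate of the orbit. Taking \<open>G\<close> itself as vertex set of every tree
  removes this obstacle: an element acts on vertices by left multiplication, and the permutation of
  the unbounded factors says to which tree the result belongs. This permutation is exactly
  multiplicative, although distances in the factors are preserved only up to bounded errors, because
  an unbounded factor cannot be followed by two different factors. So the linear parts form a
  genuine homomorphism, and the metric errors affect only their norms. Bounded factors are left out,
  as they would spoil this uniqueness; they change orbit distances by at most a constant.\<close>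

lemma successively_relpowp:
  assumes "successively E p" "p \<noteq> []"
  shows "(E ^^ (length p - 1)) (hd p) (last p)"
  using assms
proof (induction p rule: induct_list012)
  case (3 x y zs)
  then show ?case
    using relpowp_Suc_I2[of E x y "length zs" "last (y # zs)"] by simp
qed auto

lemma walk_of_relpowp:
  assumes G: "simple_graph V E" and "u \<in> V" "(E ^^ n) u v"
  shows "\<exists>p. walk_between V E u p v \<and> length p = Suc n"
  using assms(2,3)
proof (induction n arbitrary: u)
  case 0
  then show ?case by (intro exI[of _ "[u]"]) (auto simp: walk_between_def)
next
  case (Suc n)
  from Suc.prems(2) obtain w where w: "E u w" "(E ^^ n) w v"
    using relpowp_Suc_D2[of n E u v] by blast
  then have "w \<in> V" using G by (auto simp: simple_graph_def)
  from Suc.IH[OF this w(2)] obtain p where "walk_between V E w p v" "length p = Suc n" by blast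
  then show ?case using w(1) \<open>u \<in> V\<close>
    by (intro exI[of _ "u # p"]) (auto simp: walk_between_def successively_Cons)
qed

lemma relpowp_of_walk:
  assumes "walk_between V E u p v" "length p = Suc n"
  shows "u \<in> V \<and> v \<in> V \<and> (E ^^ n) u v"
  using assms successively_relpowp[of E p] hd_in_set[of p] last_in_set[of p]
  by (auto simp: walk_between_def)

text \<open>Powers of the edge relation replace walks, since they compose and reverse without any
  manipulation of lists.\<close>

lemma path_dist_eq_Least:
  assumes "simple_graph V E" "u \<in> V"
  shows "path_dist V E u v = real (LEAST n. (E ^^ n) u v)"
proof -
  have "(\<exists>p. walk_between V E u p v \<and> length p = Suc n) \<longleftrightarrow> (E ^^ n) u v" for n
    using walk_of_relpowp[OF assms] relpowp_of_walk by metis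
  then show ?thesis by (simp add: path_dist_def)
qed

lemma relpowp_sym:
  assumes "\<And>x y. E x y \<Longrightarrow> E y x" "(E ^^ n) u v"
  shows "(E ^^ n) v u"
  using assms(2)
proof (induction n arbitrary: v)
  case (Suc n)
  then obtain w where "(E ^^ n) u w" "E w v" by auto
  then show ?case using Suc.IH assms(1) by (blast intro: relpowp_Suc_I2)
qed auto

locale rooted_tree =
  fixes V :: "'v set" and E :: "'v \<Rightarrow> 'v \<Rightarrow> bool" and root :: 'v
  assumes tree: "simplicial_tree V E" and root_in [simp]: "root \<in> V"
begin

abbreviation dT :: "'v \<Rightarrow> 'v \<Rightarrow> real" where "dT \<equiv> path_dist V E"

lemma graph: "simple_graph V E" and no_cycle: "\<not> graph_cycle E p"
  using tree by (auto simp: simplicial_tree_def)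

lemma edge_in: "E u v \<Longrightarrow> u \<in> V \<and> v \<in> V" and edge_sym: "E u v \<Longrightarrow> E v u"
  and edge_neq: "E u v \<Longrightarrow> u \<noteq> v"
  using graph by (auto simp: simple_graph_def)

lemma reachable:
  assumes "u \<in> V" "v \<in> V"
  shows "\<exists>n. (E ^^ n) u v"
proof -
  obtain p where "walk_between V E u p v"
    using tree assms unfolding simplicial_tree_def graph_connected_def by blast
  moreover from this have "length p = Suc (length p - 1)"
    by (cases p) (auto simp: walk_between_def)
  ultimately show ?thesis using relpowp_of_walk by metis
qed

lemma dT_le: "u \<in> V \<Longrightarrow> (E ^^ n) u v \<Longrightarrow> dT u v \<le> n"
  by (simp add: path_dist_eq_Least[OF graph] Least_le)

lemma dT_attained:
  assumes "u \<in> V" "v \<in> V"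
  obtains n where "(E ^^ n) u v" "dT u v = n"
  using LeastI_ex[OF reachable[OF assms]] path_dist_eq_Least[OF graph assms(1)] by metis

lemma metric_path_dist: "Metric_space V dT"
proof
  fix x y z
  show "0 \<le> dT x y" by (simp add: path_dist_def)
  have le: "dT u v \<le> dT v u" if uv: "u \<in> V" "v \<in> V" for u v
  proof -
    obtain n where "(E ^^ n) v u" "dT v u = n" using dT_attained[OF uv(2,1)] .
    then show ?thesis using dT_le[OF uv(1), of n v] relpowp_sym[of E n v u] edge_sym by simp
  qed
  show "dT x y = dT y x"
  proof (cases "x \<in> V \<and> y \<in> V")
    case True
    then show ?thesis using le by (simp add: order_antisym)
  next
    case False
    \<comment> \<open>The locale asks for symmetry on the whole type. If an endpoint is outside
      \<open>V\<close>, there is no walk in either direction and both distances are the same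
      \<open>LEAST\<close> of an empty predicate.\<close>
    have "\<not> walk_between V E u p v" if "\<not> (u \<in> V \<and> v \<in> V)" for u p v
      using that unfolding walk_between_def by (metis hd_in_set last_in_set subsetD)
    then show ?thesis using False by (auto simp: path_dist_def)
  qed
  assume xy: "x \<in> V" "y \<in> V"
  show "dT x y = 0 \<longleftrightarrow> x = y"
  proof
    assume "dT x y = 0"
    then show "x = y" using dT_attained[OF xy] by force
  next
    assume "x = y"
    then show "dT x y = 0" using dT_le[OF xy(1), of 0 y] by (simp add: path_dist_def)
  qed
  assume z: "z \<in> V"
  obtain m where m: "(E ^^ m) x y" "dT x y = m" using dT_attained[OF xy] .
  obtain n where n: "(E ^^ n) y z" "dT y z = n" using dT_attained[OF xy(2) z] .
  have "(E ^^ (m + n)) x z" using m(1) n(1) by (auto simp: relpowp_add)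
  then show "dT x z \<le> dT x y + dT y z" using dT_le[OF xy(1), of "m + n" z] m(2) n(2) by simp
qed

sublocale dT: Metric_space V dT
  by (rule metric_path_dist)

section \<open>Levels, parents and common ancestors\<close>

definition lev :: "'v \<Rightarrow> nat" where
  "lev v = (LEAST n. (E ^^ n) root v)"

definition par :: "'v \<Rightarrow> 'v" where
  "par v = (SOME u. E u v \<and> lev v = Suc (lev u))"

text \<open>The index is the level of the ancestor, not the number of steps towards the root; for
  \<open>k\<close> above \<open>lev v\<close> truncated subtraction yields \<open>v\<close>
  itself.\<close>

definition anc :: "'v \<Rightarrow> nat \<Rightarrow> 'v" where
  "anc v k = (par ^^ (lev v - k)) v"

lemma relpowp_lev: "v \<in> V \<Longrightarrow> (E ^^ lev v) root v"
  unfolding lev_def by (rule LeastI_ex) (simp add: reachable)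

lemma lev_le: "(E ^^ n) root v \<Longrightarrow> lev v \<le> n"
  unfolding lev_def by (rule Least_le)

lemma dT_root: "dT root v = lev v"
  using path_dist_eq_Least[OF graph root_in] by (simp add: lev_def)

lemma lev_root [simp]: "lev root = 0"
  using lev_le[of 0 root] by simp

lemma lev_edge: "E u v \<Longrightarrow> lev v \<le> Suc (lev u)"
  using relpowp_lev[of u] edge_in[of u v] by (intro lev_le) auto

lemma lev_0D: "v \<in> V \<Longrightarrow> lev v = 0 \<Longrightarrow> v = root"
  using relpowp_lev[of v] by simp

lemma par:
  assumes "v \<in> V" "lev v \<noteq> 0"
  shows "E (par v) v \<and> lev v = Suc (lev (par v))"
proof -
  obtain n where n: "lev v = Suc n" using assms(2) by (cases "lev v") auto
  then obtain u where u: "(E ^^ n) root u" "E u v"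
    using relpowp_lev[OF assms(1)] by auto
  then have "lev v = Suc (lev u)" using lev_le[of n u] lev_edge[of u v] n by simp
  with u show ?thesis unfolding par_def by (metis (mono_tags, lifting) someI_ex)
qed

text \<open>Replace both ends by their parents until these coincide. The ends are on a higher level
  than the path that joins their parents, so no vertex repeats. The bound on levels lets a vertex
  further up close the path to a cycle.\<close>

lemma same_level_path:
  assumes "x \<in> V" "y \<in> V" "lev x = n" "lev y = n" "x \<noteq> y"
  shows "\<exists>p. hd p = x \<and> last p = y \<and> length p \<ge> 3 \<and> distinct p \<and> successively E p \<and>
    (\<forall>z\<in>set p. lev z \<le> n)"
  using assms
proof (induction n arbitrary: x y)
  case 0
  then show ?case using lev_0D by metis
next
  case (Suc n)
  have px: "E (par x) x" "lev (par x) = n" and py: "E (par y) y" "lev (par y) = n"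
    using par[of x] par[of y] Suc.prems by auto
  show ?case
  proof (cases "par x = par y")
    case True
    then show ?thesis using px py Suc.prems edge_sym[OF px(1)]
        edge_neq[OF px(1)] edge_neq[OF py(1)]
      by (intro exI[of _ "[x, par x, y]"]) auto
  next
    case False
    obtain p where p: "hd p = par x" "last p = par y" "length p \<ge> 3" "distinct p"
      "successively E p" "\<forall>z\<in>set p. lev z \<le> n"
      using Suc.IH[OF _ _ px(2) py(2) False] edge_in px py by blast
    have "p \<noteq> []" using p(3) by auto
    moreover have "x \<notin> set p" "y \<notin> set p" using p(6) Suc.prems by fastforce+
    ultimately show ?thesis using p py Suc.prems edge_sym[OF px(1)]
      by (intro exI[of _ "x # p @ [y]"])
        (auto simp: successively_append_iff successively_Cons)
  qed
qed

text \<open>Acyclicity enters here: an edge within a level, or a second neighbour one level closer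
  to the root, would close a path of \<open>same_level_path\<close> to a cycle.\<close>

lemma edge_cases:
  assumes "E u v"
  shows "(lev v = Suc (lev u) \<and> par v = u) \<or> (lev u = Suc (lev v) \<and> par u = v)"
proof -
  have in_V: "u \<in> V" "v \<in> V" using edge_in assms by auto
  have parI: "par y = x" if e: "E x y" and l: "lev y = Suc (lev x)" for x y
  proof (rule ccontr)
    assume neq: "par y \<noteq> x"
    have y: "E (par y) y" "lev (par y) = lev x" using par[of y] edge_in[OF e] l by auto
    obtain p where p: "hd p = par y" "last p = x" "length p \<ge> 3" "distinct p"
      "successively E p" "\<forall>z\<in>set p. lev z \<le> lev x"
      using same_level_path[OF _ _ y(2) refl neq] edge_in e y(1) by blast
    have "y \<notin> set p" "p \<noteq> []" using p(3,6) l by auto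
    then have "graph_cycle E (y # p)" using p e edge_sym[OF y(1)]
      by (auto simp: graph_cycle_def successively_Cons)
    then show False using no_cycle by blast
  qed
  have "lev u \<noteq> lev v"
  proof
    assume eq: "lev u = lev v"
    obtain p where "hd p = u" "last p = v" "length p \<ge> 3" "distinct p" "successively E p"
      using same_level_path[OF in_V eq refl edge_neq[OF assms]] by blast
    then have "graph_cycle E p" using edge_sym[OF assms] by (auto simp: graph_cycle_def)
    then show False using no_cycle by blast
  qed
  then have "lev v = Suc (lev u) \<or> lev u = Suc (lev v)"
    using lev_edge[OF assms] lev_edge[OF edge_sym[OF assms]] by linarith
  then show ?thesis
    using parI[OF assms] parI[OF edge_sym[OF assms]] by blast
qed

lemma par_funpow:
  assumes "v \<in> V" "i \<le> lev v"
  shows "(par ^^ i) v \<in> V \<and> lev ((par ^^ i) v) = lev v - i \<and> (E ^^ i) ((par ^^ i) v) v"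
  using assms
proof (induction i)
  case (Suc i)
  let ?w = "(par ^^ i) v"
  have w: "?w \<in> V" "lev ?w = lev v - i" "(E ^^ i) ?w v" using Suc by auto
  then have "E (par ?w) ?w" "lev ?w = Suc (lev (par ?w))" using par[of ?w] Suc.prems by auto
  then show ?case using w edge_in[of "par ?w" ?w] relpowp_Suc_I2[of E "par ?w" ?w i v] by simp
qed simp

lemma anc_in [simp]: "v \<in> V \<Longrightarrow> anc v k \<in> V"
  and lev_anc [simp]: "v \<in> V \<Longrightarrow> k \<le> lev v \<Longrightarrow> lev (anc v k) = k"
  and relpowp_anc: "v \<in> V \<Longrightarrow> (E ^^ (lev v - k)) (anc v k) v"
  using par_funpow[of v "lev v - k"] by (auto simp: anc_def)

lemma anc_lev [simp]: "anc v (lev v) = v"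
  by (simp add: anc_def)

lemma anc_anc:
  assumes "v \<in> V" "j \<le> k" "k \<le> lev v"
  shows "anc (anc v k) j = anc v j"
proof -
  have "(par ^^ (k - j)) ((par ^^ (lev v - k)) v) = (par ^^ (lev v - j)) v"
    using assms by (simp flip: funpow_add[THEN fun_cong, unfolded o_def])
  then show ?thesis using lev_anc[OF assms(1,3)] by (simp add: anc_def)
qed

lemma anc_edge:
  assumes "E u v" "k \<le> lev u" "k \<le> lev v"
  shows "anc u k = anc v k"
proof -
  have "anc x k = anc y k" if "lev y = Suc (lev x)" "par y = x" "k \<le> lev x" for x y
    using that by (simp add: anc_def Suc_diff_le funpow_swap1)
  then show ?thesis using edge_cases[OF assms(1)] assms by metis
qed

text \<open>An invariant of walks from \<open>u\<close>: a step below level \<open>j\<close> lowers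
  the common ancestor by one level, and the increase of \<open>n\<close> pays for this. For a
  shortest walk it gives the hard half of the distance formula \<open>dT_meet\<close>.\<close>

lemma walk_meet:
  assumes "u \<in> V" "(E ^^ n) u v"
  shows "\<exists>j. j \<le> lev u \<and> j \<le> lev v \<and> anc u j = anc v j \<and> lev u + lev v \<le> n + 2 * j"
  using assms(2)
proof (induction n arbitrary: v)
  case 0
  then show ?case by (intro exI[of _ "lev u"]) auto
next
  case (Suc n)
  then obtain w where w: "(E ^^ n) u w" "E w v" by auto
  have wV: "w \<in> V" using w(2) edge_in by blast
  obtain j where j: "j \<le> lev u" "j \<le> lev w" "anc u j = anc w j" "lev u + lev w \<le> n + 2 * j"
    using Suc.IH[OF w(1)] by blast
  show ?case
  proof (cases "j \<le> lev v")
    case True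
    then show ?thesis using j anc_edge[OF w(2)] edge_cases[OF w(2)]
      by (intro exI[of _ j]) auto
  next
    case False
    then have l: "lev w = Suc (lev v)" "j = Suc (lev v)" using j(2) edge_cases[OF w(2)] by auto
    have "anc u (lev v) = anc w (lev v)"
      using anc_anc[OF assms(1), of "lev v" j] anc_anc[OF wV, of "lev v" j] j l by simp
    then show ?thesis using j l anc_edge[OF w(2), of "lev v"]
      by (intro exI[of _ "lev v"]) auto
  qed
qed

lemma dT_le_anc:
  assumes "u \<in> V" "v \<in> V" "j \<le> lev u" "j \<le> lev v" "anc u j = anc v j"
  shows "dT u v \<le> real (lev u) + real (lev v) - 2 * real j"
proof -
  have "dT u (anc u j) \<le> lev u - j" "dT (anc u j) v \<le> lev v - j"
    using dT_le[OF _ relpowp_anc[of u j]] dT_le[OF _ relpowp_anc[of v j]] assms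
    by (auto simp: dT.commute)
  then show ?thesis using dT.triangle[of u "anc u j" v] assms by auto
qed

lemma dT_meet:
  assumes "u \<in> V" "v \<in> V"
  obtains j where "j \<le> lev u" "j \<le> lev v" "anc u j = anc v j"
    "dT u v = real (lev u) + real (lev v) - 2 * real j"
proof -
  obtain n where n: "(E ^^ n) u v" "dT u v = n" using dT_attained[OF assms] by blast
  obtain j where j: "j \<le> lev u" "j \<le> lev v" "anc u j = anc v j" "lev u + lev v \<le> n + 2 * j"
    using walk_meet[OF assms(1) n(1)] by blast
  have "dT u v = real (lev u) + real (lev v) - 2 * real j"
    using dT_le_anc[OF assms j(1-3)] j(4) n(2) by linarith
  with j that show thesis by blast
qed

text \<open>A path that enters the subtree above \<open>anc w k\<close> passes through this vertex
  and still has to climb to \<open>w\<close>.\<close>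

lemma step_into_subtree:
  assumes "u \<in> V" "w \<in> V" "k \<le> lev w" "\<not> (k \<le> lev u \<and> anc u k = anc w k)"
  shows "real (lev w) - real k \<le> dT u w"
proof -
  obtain j where j: "j \<le> lev u" "j \<le> lev w" "anc u j = anc w j"
    "dT u w = real (lev u) + real (lev w) - 2 * real j"
    using dT_meet[OF assms(1,2)] .
  have "j < k"
  proof (rule ccontr)
    assume "\<not> j < k"
    then have "anc u k = anc w k" "k \<le> lev u"
      using anc_anc[OF assms(1), of k j] anc_anc[OF assms(2), of k j] j by auto
    then show False using assms(4) by blast
  qed
  then show ?thesis using j by simp
qed

end

section \<open>Trees on a set, encoded by ancestors\<close>

definition symdiff :: "'a set \<Rightarrow> 'a set \<Rightarrow> 'a set" where
  "symdiff A B = (A - B) \<union> (B - A)"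

lemma card_symdiff: "finite A \<Longrightarrow> finite B \<Longrightarrow> card (symdiff A B) = card (A - B) + card (B - A)"
  unfolding symdiff_def by (subst card_Un_disjoint) auto

text \<open>The sets \<open>A g\<close> are the sets of ancestors of the vertices of a tree on \<open>M\<close> with root \<open>b\<close>, where
  each vertex counts as its own ancestor and the root is left out.\<close>

definition ancestor_system :: "'g set \<Rightarrow> 'g \<Rightarrow> ('g \<Rightarrow> 'g set) \<Rightarrow> bool" where
  "ancestor_system M b A \<longleftrightarrow> A b = {} \<and> (\<forall>g\<in>M. finite (A g) \<and> A g \<subseteq> M - {b}) \<and>
     (\<forall>g\<in>M - {b}. \<exists>p\<in>M. A g = insert g (A p) \<and> g \<notin> A p)"

context rooted_tree
begin

text \<open>A discrete intermediate value argument: some step of the chain enters the subtree above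
  \<open>m\<close>, and a step of length at most \<open>K\<close> lands at most \<open>K\<close>
  levels above \<open>m\<close>.\<close>

lemma chain_crossing:
  assumes "R\<^sup>*\<^sup>* x y" and step: "\<And>u v. R u v \<Longrightarrow> f u \<in> V \<and> f v \<in> V \<and> dT (f u) (f v) \<le> K"
    and "k \<le> lev (f y)" "anc (f y) k = m" "\<not> (k \<le> lev (f x) \<and> anc (f x) k = m)"
  shows "\<exists>u z. R u z \<and> k \<le> lev (f z) \<and> anc (f z) k = m \<and> real (lev (f z)) \<le> real k + K"
  using assms(1,3,4)
proof (induction rule: rtranclp_induct)
  case base
  then show ?case using assms(5) by simp
next
  case (step y z)
  show ?case
  proof (cases "k \<le> lev (f y) \<and> anc (f y) k = m")
    case True
    then show ?thesis using step.IH by blast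
  next
    case False
    then have "real (lev (f z)) - real k \<le> dT (f y) (f z)"
      using step_into_subtree[of "f y" "f z" k] assms(2)[OF step.hyps(2)] step.prems by simp
    then show ?thesis using step.hyps(2) step.prems assms(2)[OF step.hyps(2)]
      by (intro exI[of _ y] exI[of _ z]) auto
  qed
qed

lemma lev_lipschitz:
  assumes "u \<in> V" "v \<in> V"
  shows "real (lev u) \<le> real (lev v) + dT u v"
  using dT.triangle[of root v u] assms by (simp add: dT_root dT.commute)

text \<open>Cut the tree at the levels divisible by \<open>L > K\<close>. As \<open>f\<close> is coarsely connected, every cut
  vertex \<open>c\<close> that is an ancestor of a point of the image has a descendant in the image less than \<open>L\<close>
  levels above it; one such point represents \<open>c\<close>. Distinct cut vertices have distinct
  representatives, which therefore form a tree, and the other elements of \<open>M\<close> are attached to it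
  as leaves.\<close>

lemma ancestor_system_of_tree_map:
  fixes f :: "'g \<Rightarrow> 'v" and K :: nat
  assumes f: "f \<in> M \<rightarrow> V" and b: "b \<in> M" "f b = root"
    and chain: "\<And>g. g \<in> M \<Longrightarrow> (\<lambda>u v. u \<in> M \<and> v \<in> M \<and> dT (f u) (f v) \<le> K)\<^sup>*\<^sup>* b g"
  defines "L \<equiv> Suc K"
  shows "\<exists>A. ancestor_system M b A \<and> (\<forall>g\<in>M. \<forall>h\<in>M.
    real (card (symdiff (A g) (A h))) \<le> dT (f g) (f h) + 4 \<and>
    dT (f g) (f h) \<le> L * (real (card (symdiff (A g) (A h))) + 4))"
proof -
  have fV [simp]: "g \<in> M \<Longrightarrow> f g \<in> V" for g using f by auto
  have L: "L > 0" by (simp add: L_def)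
  \<comment> \<open>Setting \<open>r root\<close> to \<open>b\<close> makes \<open>b\<close> the
    root of the new tree. For the other cut vertices \<open>chain_crossing\<close> provides a
    representative, as the chain starts outside their subtrees.\<close>
  define r where "r c = (if c = root then b else
    SOME w. w \<in> M \<and> lev c \<le> lev (f w) \<and> lev (f w) \<le> lev c + K \<and> anc (f w) (lev c) = c)" for c
  have r: "r (anc (f g) k) \<in> M \<and> k \<le> lev (f (r (anc (f g) k))) \<and> lev (f (r (anc (f g) k))) \<le> k + K \<and>
    anc (f (r (anc (f g) k))) k = anc (f g) k" if g: "g \<in> M" and k: "k \<le> lev (f g)" for g k
  proof (cases "k = 0")
    case True
    then have "anc (f g) k = root" using lev_0D[of "anc (f g) k"] g by simp
    then show ?thesis using b True anc_lev[of root] by (simp add: r_def)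
  next
    case False
    let ?c = "anc (f g) k"
    have c: "lev ?c = k" using g k by simp
    then have "?c \<noteq> root" using False by auto
    have "\<exists>u z. (u \<in> M \<and> z \<in> M \<and> dT (f u) (f z) \<le> K) \<and> k \<le> lev (f z) \<and> anc (f z) k = ?c \<and>
        real (lev (f z)) \<le> real k + K"
      using chain_crossing[OF chain[OF g], of f K k ?c] g k False b by simp
    then have "\<exists>w. w \<in> M \<and> k \<le> lev (f w) \<and> lev (f w) \<le> k + K \<and> anc (f w) k = ?c"
      by (metis of_nat_add of_nat_le_iff)
    from someI_ex[OF this] show ?thesis using c \<open>?c \<noteq> root\<close> by (simp add: r_def)
  qed
  define N where "N g = lev (f g) div L" for g
  define rep where "rep g n = r (anc (f g) (n * L))" for g n
  have N_iff: "n \<le> N g \<longleftrightarrow> n * L \<le> lev (f g)" for n g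
    using L by (simp add: N_def less_eq_div_iff_mult_less_eq)
  have rep: "rep g n \<in> M" "N (rep g n) = n" "anc (f (rep g n)) (n * L) = anc (f g) (n * L)"
    if "g \<in> M" "n \<le> N g" for g n
  proof -
    note * = r[OF that(1), of "n * L", folded rep_def] that(2)[unfolded N_iff]
    show "rep g n \<in> M" "anc (f (rep g n)) (n * L) = anc (f g) (n * L)" using * by auto
    \<comment> \<open>The level of a representative lies between \<open>n * L\<close> and
      \<open>n * L + K\<close>, where \<open>K\<close> is \<open>L - 1\<close>: hence the choice of
      \<open>L\<close>. So \<open>N\<close> recovers \<open>n\<close>, and representatives of
      different cut levels differ.\<close>
    show "N (rep g n) = n" unfolding N_def
      by (rule div_nat_eqI) (use * in \<open>auto simp: L_def algebra_simps\<close>)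
  qed
  have rep_rep: "rep (rep g n) m = rep g m" if "g \<in> M" "n \<le> N g" "m \<le> n" for g m n
  proof -
    have ml: "m * L \<le> n * L" using that(3) by simp
    have "anc (f (rep g n)) (m * L) = anc (anc (f (rep g n)) (n * L)) (m * L)"
      using anc_anc[of "f (rep g n)" "m * L" "n * L"] rep[OF that(1,2)] ml N_iff[of n "rep g n"]
      by simp
    also have "\<dots> = anc (f g) (m * L)"
      using anc_anc[of "f g" "m * L" "n * L"] rep(3)[OF that(1,2)] ml N_iff[of n g] that by simp
    finally show ?thesis by (simp add: rep_def)
  qed
  have rep_0: "rep g 0 = b" if "g \<in> M" for g
    using lev_0D[of "anc (f g) 0"] that by (simp add: rep_def r_def)
  define A where "A g = insert g (rep g ` {..N g}) - {b}" for g
  have A_rep: "A (rep g n) = rep g ` {..n} - {b}" if "g \<in> M" "n \<le> N g" for g n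
  proof -
    have "rep (rep g n) ` {..n} = rep g ` {..n}" using rep_rep[OF that] by (intro image_cong) auto
    then show ?thesis using rep(2)[OF that] by (auto simp: A_def)
  qed
  \<comment> \<open>If \<open>g\<close> represents the highest cut vertex below \<open>f g\<close>,
    its parent represents the preceding one; otherwise \<open>g\<close> is a leaf attached to
    \<open>rep g (N g)\<close>.\<close>
  have parent: "\<exists>p\<in>M. A g = insert g (A p) \<and> g \<notin> A p" if g: "g \<in> M" "g \<noteq> b" for g
  proof (cases "g = rep g (N g)")
    case False
    have "g \<noteq> rep g n" if "n \<le> N g" for n using rep(2)[OF g(1) that] False by metis
    then show ?thesis using g rep(1)[OF g(1) order_refl] A_rep[OF g(1) order_refl]
      by (intro bexI[of _ "rep g (N g)"]) (auto simp: A_def)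
  next
    case True
    then have "N g \<noteq> 0" using rep_0 g by metis
    then obtain n where n: "N g = Suc n" by (cases "N g") auto
    have "g \<noteq> rep g m" if "m \<le> n" for m using rep(2)[OF g(1), of m] that n by fastforce
    moreover have "{..N g} = insert (N g) {..n}" using n by auto
    moreover have "n \<le> N g" using n by simp
    ultimately show ?thesis using g rep(1)[OF g(1), of n] A_rep[OF g(1), of n] True
      by (intro bexI[of _ "rep g n"]) (auto simp: A_def)
  qed
  have "rep b ` {..N b} = {b}" using rep_0[OF b(1)] by (simp add: N_def b)
  then have "A b = {}" by (simp add: A_def)
  then have sys: "ancestor_system M b A"
    using parent rep(1) by (auto simp: ancestor_system_def A_def)
  have fin: "finite (A g)" for g by (simp add: A_def)
  \<comment> \<open>The cut vertices below \<open>f g\<close> and \<open>f h\<close> agree up to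
    level \<open>j\<close> and differ above it, so \<open>B\<close> counts the difference. In either
    bound one unit of the \<open>2\<close> comes from a leaf (\<open>g\<close> or \<open>h\<close>),
    the other from rounding by \<open>div\<close>.\<close>
  have diff: "real (card (A g - A h)) \<le> real (lev (f g)) - real j + 2 \<and>
      (real (lev (f g)) - real j) / L - 2 \<le> real (card (A g - A h))"
    if gh: "g \<in> M" "h \<in> M" and j: "j \<le> lev (f g)" "j \<le> lev (f h)" "anc (f g) j = anc (f h) j"
      and dj: "dT (f g) (f h) = real (lev (f g)) + real (lev (f h)) - 2 * real j" for g h j
  proof -
    define B where "B = {j div L<..N g}"
    have B_iff: "n \<in> B \<longleftrightarrow> n \<le> N g \<and> j < n * L" for n
      using L by (auto simp: B_def div_less_iff_less_mult)
    have inj: "inj_on (rep g) B" using rep(2)[OF gh(1)] B_iff by (metis inj_onI)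
    have cardB: "card (rep g ` B) = N g - j div L"
      using card_image[OF inj] by (simp add: B_def)
    have jN: "j div L \<le> N g" using j(1) by (simp add: N_def div_le_mono)
    have "A g - A h \<subseteq> insert g (rep g ` B)"
    proof
      fix x assume x: "x \<in> A g - A h"
      show "x \<in> insert g (rep g ` B)"
      proof (rule ccontr)
        assume no: "x \<notin> insert g (rep g ` B)"
        then obtain n where n: "x = rep g n" "n \<le> N g" using x by (auto simp: A_def)
        then have nj: "n * L \<le> j" using no B_iff by auto
        have "anc (f g) (n * L) = anc (f h) (n * L)"
          using anc_anc[of "f g" "n * L" j] anc_anc[of "f h" "n * L" j] nj j gh by simp
        then have "x = rep h n" using n by (simp add: rep_def)
        moreover have "n \<le> N h" using nj j(2) N_iff[of n h] by simp
        ultimately show False using x by (auto simp: A_def)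
      qed
    qed
    then have "card (A g - A h) \<le> card (insert g (rep g ` B))"
      by (intro card_mono) (auto simp: B_def)
    also have "\<dots> \<le> Suc (N g - j div L)"
      using cardB by (simp add: card_insert_if B_def)
    finally have up: "card (A g - A h) \<le> Suc (N g - j div L)" .
    have "rep g ` B - {h} \<subseteq> A g - A h"
    proof
      fix x assume "x \<in> rep g ` B - {h}"
      then obtain n where n: "x = rep g n" "n \<le> N g" "j < n * L" "x \<noteq> h" using B_iff by auto
      have "N b = 0" by (simp add: N_def b)
      then have "x \<noteq> b" using rep(2)[OF gh(1) n(2)] n by auto
      moreover have "x \<noteq> rep h m" if m: "m \<le> N h" for m
      proof
        assume eq: "x = rep h m"
        then have "m = n" using rep(2)[OF gh(1) n(2)] rep(2)[OF gh(2) m] n by simp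
        then have "anc (f g) (n * L) = anc (f h) (n * L)"
          using rep(3)[OF gh(1) n(2)] rep(3)[OF gh(2) m] eq n by simp
        \<comment> \<open>A common ancestor above level \<open>j\<close> would make the distance
          smaller than \<open>dj\<close> says.\<close>
        then have "dT (f g) (f h) \<le> real (lev (f g)) + real (lev (f h)) - 2 * real (n * L)"
          using dT_le_anc[of "f g" "f h" "n * L"] gh n(2) m \<open>m = n\<close> N_iff by simp
        then show False using dj n(3) by linarith
      qed
      ultimately show "x \<in> A g - A h" using n by (auto simp: A_def)
    qed
    then have "card (rep g ` B - {h}) \<le> card (A g - A h)" using fin by (intro card_mono) auto
    moreover have "card (rep g ` B) - 1 \<le> card (rep g ` B - {h})"
      by (simp add: card_Diff_singleton_if)
    ultimately have low: "N g - j div L \<le> Suc (card (A g - A h))" using cardB by simp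
    have q: "real (x div L) \<le> x / L \<and> x / L \<le> real (x div L) + 1" for x
      using real_of_int_div2[of "int x" "int L"] real_of_int_div3[of "int x" "int L"]
      by (simp flip: zdiv_int)
    have lj: "(real (lev (f g)) - real j) / L \<le> real (lev (f g)) - real j"
      using divide_left_mono[of 1 "real L" "real (lev (f g)) - real j"] j(1) L by simp
    have e: "real (N g - j div L) = real (N g) - real (j div L)" using jN by simp
    show ?thesis
      using up low e q[of "lev (f g)"] q[of j] lj by (simp add: N_def diff_divide_distrib)
  qed
  have "real (card (symdiff (A g) (A h))) \<le> dT (f g) (f h) + 4 \<and>
    dT (f g) (f h) \<le> L * (real (card (symdiff (A g) (A h))) + 4)" if gh: "g \<in> M" "h \<in> M" for g h
  proof -
    obtain j where j: "j \<le> lev (f g)" "j \<le> lev (f h)" "anc (f g) j = anc (f h) j"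
      "dT (f g) (f h) = real (lev (f g)) + real (lev (f h)) - 2 * real j"
      using dT_meet[of "f g" "f h"] gh by auto
    have "dT (f h) (f g) = real (lev (f h)) + real (lev (f g)) - 2 * real j"
      using j(4) dT.commute[of "f h" "f g"] by simp
    note d = diff[OF gh j] diff[OF gh(2,1) j(2,1) j(3)[symmetric] this]
    have "dT (f g) (f h) / L - 4 \<le> real (card (A g - A h)) + real (card (A h - A g))"
      using d j(4) by (simp add: add_divide_distrib diff_divide_distrib)
    then have "dT (f g) (f h) \<le> L * (real (card (symdiff (A g) (A h))) + 4)"
      using L card_symdiff[OF fin fin, of g h] by (simp add: field_simps)
    then show ?thesis using d j(4) card_symdiff[OF fin fin, of g h] by simp
  qed
  then show ?thesis using sys by blast
qed

end

section \<open>Quasi-trees\<close>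

abbreviation coarse_step :: "'x set \<Rightarrow> ('x \<Rightarrow> 'x \<Rightarrow> real) \<Rightarrow> real \<Rightarrow> 'x \<Rightarrow> 'x \<Rightarrow> bool" where
  "coarse_step X d K u v \<equiv> u \<in> X \<and> v \<in> X \<and> d u v \<le> K"

locale quasi_tree_chart = Metric_space X d
  for X :: "'x set" and d :: "'x \<Rightarrow> 'x \<Rightarrow> real" +
  fixes V :: "'v set" and E and t :: "'x \<Rightarrow> 'v" and A C :: real
  assumes tree: "simplicial_tree V E" and t_in: "x \<in> X \<Longrightarrow> t x \<in> V"
    and A_ge_1: "A \<ge> 1" and C_pos: "C > 0"
    and upper: "x \<in> X \<Longrightarrow> y \<in> X \<Longrightarrow> path_dist V E (t x) (t y) \<le> A * d x y + A"
    and lower: "x \<in> X \<Longrightarrow> y \<in> X \<Longrightarrow> d x y \<le> A * path_dist V E (t x) (t y) + A * A"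
    and dense: "v \<in> V \<Longrightarrow> \<exists>x\<in>X. path_dist V E v (t x) < C"

lemma quasi_tree_has_chart:
  assumes "quasi_tree TYPE('v) X d"
  shows "\<exists>(V :: 'v set) E t A C. quasi_tree_chart X d V E t A C"
proof -
  obtain V :: "'v set" and E t where *: "Metric_space X d" "simplicial_tree V E"
    "quasi_isometry X d V (path_dist V E) t"
    using assms unfolding quasi_tree_def by blast
  obtain A where A: "A \<ge> 1" "\<And>x y. x \<in> X \<Longrightarrow> y \<in> X \<Longrightarrow>
      (1 / A) * d x y - A \<le> path_dist V E (t x) (t y) \<and> path_dist V E (t x) (t y) \<le> A * d x y + A"
    using *(3) unfolding quasi_isometry_def qi_embedding_def by blast
  have lower: "d x y \<le> A * path_dist V E (t x) (t y) + A * A" if "x \<in> X" "y \<in> X" for x y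
    using A(2)[OF that] A(1) by (simp add: field_simps)
  obtain root where root: "root \<in> V"
    using *(2) by (auto simp: simplicial_tree_def graph_connected_def)
  then interpret rooted_tree V E root using *(2) by unfold_locales
  obtain C where C: "C > 0" "\<forall>y\<in>V. dT.mball y C \<inter> t ` X \<noteq> {}"
    using *(3) unfolding quasi_isometry_def by blast
  have dense: "\<exists>x\<in>X. dT v (t x) < C" if "v \<in> V" for v
    using C(2) that by (fastforce simp: dT.mball_def)
  have "t x \<in> V" if "x \<in> X" for x using *(3) that by (auto simp: quasi_isometry_def)
  with * A C(1) lower dense have "quasi_tree_chart X d V E t A C"
    by (simp add: quasi_tree_chart_def quasi_tree_chart_axioms_def)
  then show ?thesis by blast
qed

text \<open>Along a walk in the tree, replace each vertex by a point of \<open>X\<close> with image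
  within \<open>C\<close>. Consecutive replacements have images at distance at most
  \<open>2 * C + 1\<close>, which \<open>lower\<close> converts into \<open>K\<close>.\<close>

lemma quasi_tree_coarsely_connected:
  assumes "quasi_tree TYPE('v) X d"
  shows "\<exists>K\<ge>0. \<forall>x\<in>X. \<forall>y\<in>X. (coarse_step X d K)\<^sup>*\<^sup>* x y"
proof -
  obtain V :: "'v set" and E t A C where "quasi_tree_chart X d V E t A C"
    using quasi_tree_has_chart[OF assms] by blast
  then interpret X: quasi_tree_chart X d V E t A C .
  note * = X.Metric_space_axioms X.tree X.t_in X.A_ge_1 X.C_pos X.upper X.lower X.dense
  obtain root where root: "root \<in> V"
    using *(2) by (auto simp: simplicial_tree_def graph_connected_def)
  then interpret rooted_tree V E root using *(2) by unfold_locales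
  define K where "K = A * (2 * C + 1) + A * A"
  have tV: "x \<in> X \<Longrightarrow> t x \<in> V" for x using *(3) by auto
  have near: "coarse_step X d K x y" if "x \<in> X" "y \<in> X" "dT (t x) (t y) \<le> 2 * C + 1" for x y
  proof -
    have "A * dT (t x) (t y) \<le> A * (2 * C + 1)" using that(3) *(4) by (intro mult_left_mono) auto
    then show ?thesis using *(7)[OF that(1,2)] that by (simp add: K_def)
  qed
  have "(coarse_step X d K)\<^sup>*\<^sup>* x z"
    if "(E ^^ n) (t x) v" "x \<in> X" "z \<in> X" "dT v (t z) < C" for n x v z
    using that
  proof (induction n arbitrary: v z)
    case 0
    then show ?case using near[of x z] *(5) by auto
  next
    case (Suc n)
    then obtain w where w: "(E ^^ n) (t x) w" "E w v" by auto
    have wv: "w \<in> V" "v \<in> V" using edge_in w by auto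
    then obtain y where y: "y \<in> X" "dT w (t y) < C" using *(8) by blast
    have "(coarse_step X d K)\<^sup>*\<^sup>* x y" using Suc.IH[OF w(1)] y Suc.prems by blast
    moreover have "dT w v \<le> 1" using dT_le[of w "Suc 0" v] w(2) wv by (simp add: relcompp_apply)
    then have "dT (t y) (t z) \<le> 2 * C + 1"
      using dT.triangle[of "t y" w "t z"] dT.triangle[of w v "t z"] Suc.prems(3,4) y tV wv
        dT.commute[of "t y" w] by simp
    then have "coarse_step X d K y z" using near y Suc.prems by blast
    ultimately show ?case by (rule rtranclp.rtrancl_into_rtrancl)
  qed
  then have "(coarse_step X d K)\<^sup>*\<^sup>* x y" if "x \<in> X" "y \<in> X" for x y
    using reachable[OF tV tV, OF that] that tV[OF that(2)] *(5) by fastforce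
  moreover have "K \<ge> 0" using *(4,5) by (simp add: K_def)
  ultimately show ?thesis by blast
qed

text \<open>The map \<open>e\<close> embeds a square, with the sum of two pseudometrics,
  isometrically into \<open>X\<close>. Both sides are parametrised by \<open>X\<close> itself and
  \<open>D1\<close>, \<open>D2\<close> are dominated by \<open>d\<close>, so the coarse
  connectedness of \<open>X\<close> makes the sides coarse paths. Squares inside the image of a line
  arise in this form.\<close>

definition small_squares :: "'x set \<Rightarrow> ('x \<Rightarrow> 'x \<Rightarrow> real) \<Rightarrow> real \<Rightarrow> bool" where
  "small_squares X d R \<longleftrightarrow> (\<forall>e D1 D2.
    (\<forall>z\<in>X. \<forall>w\<in>X. e z w \<in> X) \<longrightarrow>
    (\<forall>z\<in>X. \<forall>w\<in>X. \<forall>z'\<in>X. \<forall>w'\<in>X. d (e z w) (e z' w') = D1 z z' + D2 w w') \<longrightarrow>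
    (\<forall>z\<in>X. \<forall>w\<in>X. 0 \<le> D1 z w \<and> D1 z w \<le> d z w \<and> 0 \<le> D2 z w \<and> D2 z w \<le> d z w) \<longrightarrow>
    (\<forall>a\<in>X. \<forall>b\<in>X. \<forall>c\<in>X. \<forall>f\<in>X. D1 a b \<le> R \<or> D2 c f \<le> R))"

text \<open>Halfway between the images of opposite corners of a square in the tree there is a vertex which
  the images of both boundary paths approach. If the square is large, this brings the two paths
  close to each other far away from the two corners, which is impossible.\<close>

lemma quasi_tree_small_squares:
  assumes "quasi_tree TYPE('v) X d"
  shows "\<exists>R. small_squares X d R"
proof -
  obtain V :: "'v set" and E t A C where "quasi_tree_chart X d V E t A C"
    using quasi_tree_has_chart[OF assms] by blast
  then interpret X: quasi_tree_chart X d V E t A C .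
  note * = X.Metric_space_axioms X.tree X.t_in X.A_ge_1 X.C_pos X.upper X.lower X.dense
  obtain k0 where k0: "k0 \<ge> 0" "\<And>x y. x \<in> X \<Longrightarrow> y \<in> X \<Longrightarrow> (coarse_step X d k0)\<^sup>*\<^sup>* x y"
    using quasi_tree_coarsely_connected[OF assms] by blast
  \<comment> \<open>\<open>K\<close> bounds a coarse step seen in the tree, \<open>Q\<close> the
    distance in \<open>X\<close> between two points near the halfway vertex, and \<open>M\<close>
    the level of that vertex once a corner is within \<open>Q\<close> of such a point.
    \<open>R\<close> translates the resulting bound on \<open>lev ?q\<close> back to
    \<open>X\<close>.\<close>
  define K where "K = A * k0 + A"
  define Q where "Q = A * (2 * K) + A * A"
  define M where "M = A * Q + A + K"
  define R where "R = max Q (A * (2 * M + 1) + A * A)"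
  have K0: "K \<ge> 0" using *(4) k0 by (simp add: K_def)
  have Q0: "Q \<ge> 0" using *(4) K0 by (simp add: Q_def)
  have M0: "M \<ge> 0" using *(4) K0 Q0 by (simp add: M_def)
  have small: "D1 a b \<le> R \<or> D2 c f \<le> R"
    if e: "\<And>z w. z \<in> X \<Longrightarrow> w \<in> X \<Longrightarrow> e z w \<in> X"
      and de: "\<And>z w z' w'. \<lbrakk>z \<in> X; w \<in> X; z' \<in> X; w' \<in> X\<rbrakk> \<Longrightarrow> d (e z w) (e z' w') = D1 z z' + D2 w w'"
      and D: "\<And>z z'. \<lbrakk>z \<in> X; z' \<in> X\<rbrakk> \<Longrightarrow> 0 \<le> D1 z z' \<and> D1 z z' \<le> d z z' \<and> 0 \<le> D2 z z' \<and> D2 z z' \<le> d z z'"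
      and abcf: "a \<in> X" "b \<in> X" "c \<in> X" "f \<in> X"
    for e D1 D2 a b c f
  proof -
    have tV [simp]: "x \<in> X \<Longrightarrow> t x \<in> V" for x using *(3) by auto
    interpret rooted_tree V E "t (e a c)" using *(2) e abcf by unfold_locales auto
    have Dself: "D1 z z = 0 \<and> D2 z z = 0" if "z \<in> X" for z
      using D[OF that that] that by simp
    have K: "dT (t x) (t y) \<le> K" if "x \<in> X" "y \<in> X" "d x y \<le> k0" for x y
    proof -
      have "A * d x y \<le> A * k0" using that *(4) by (intro mult_left_mono) auto
      then show ?thesis using *(6)[OF that(1,2)] by (simp add: K_def)
    qed
    let ?q = "t (e b f)"
    define k where "k = lev ?q div 2"
    have lq: "real (lev ?q) \<le> 2 * M + 1 \<Longrightarrow> ?thesis"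
    proof -
      assume "real (lev ?q) \<le> 2 * M + 1"
      then have "A * dT (t (e a c)) ?q \<le> A * (2 * M + 1)"
        using *(4) by (intro mult_left_mono) (auto simp: dT_root)
      then have "D1 a b + D2 c f \<le> A * (2 * M + 1) + A * A"
        using *(7)[of "e a c" "e b f"] e abcf de[of a c b f] by simp
      then show ?thesis using D[OF abcf(1,2)] D[OF abcf(3,4)] by (auto simp: R_def)
    qed
    \<comment> \<open>Level \<open>0\<close> is treated apart: a crossing exists only if the root
      lies outside the subtree above \<open>?m\<close>.\<close>
    show ?thesis
    proof (cases "k = 0")
      case True
      then have "lev ?q \<le> 1" by (auto simp: k_def)
      then show ?thesis using lq M0 by simp
    next
      case k: False
      let ?m = "anc ?q k"
      define near where "near x \<longleftrightarrow> x \<in> X \<and> k \<le> lev (t x) \<and> anc (t x) k = ?m \<and> real (lev (t x)) \<le> real k + K" for x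
      have cross: "\<exists>z\<in>X. near (g z)" if "g \<in> X \<rightarrow> X" "u \<in> X" "v \<in> X"
        and lip: "\<And>z z'. z \<in> X \<Longrightarrow> z' \<in> X \<Longrightarrow> d (g z) (g z') \<le> d z z'"
        and "k \<le> lev (t (g v))" "anc (t (g v)) k = ?m" "\<not> (k \<le> lev (t (g u)) \<and> anc (t (g u)) k = ?m)"
        for g u v
      proof -
        have "t (g z) \<in> V \<and> t (g z') \<in> V \<and> dT (t (g z)) (t (g z')) \<le> K"
          if "coarse_step X d k0 z z'" for z z'
          using that K[of "g z" "g z'"] \<open>g \<in> X \<rightarrow> X\<close> order_trans[OF lip[of z z']]
          by (simp add: Pi_iff)
        from chain_crossing[OF k0(2)[OF that(2,3)], of "\<lambda>z. t (g z)" K, OF this that(5,6,7)]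
        show ?thesis using that(1) by (auto simp: near_def)
      qed
      have kq: "k \<le> lev ?q" by (simp add: k_def)
      have g: "(\<lambda>z. e a z) \<in> X \<rightarrow> X" "(\<lambda>z. e b z) \<in> X \<rightarrow> X" "(\<lambda>z. e z c) \<in> X \<rightarrow> X" "(\<lambda>z. e z f) \<in> X \<rightarrow> X"
        using e abcf by auto
      have lip: "d (e x z) (e x z') \<le> d z z'" "d (e z x) (e z' x) \<le> d z z'"
        if "x \<in> X" "z \<in> X" "z' \<in> X" for x z z'
        using that de D Dself by auto
      have root0: "\<not> (k \<le> lev (t (e a c)) \<and> anc (t (e a c)) k = ?m)" using k by simp
      \<comment> \<open>Whether the intermediate corner \<open>e a f\<close> is in the subtree
        decides which of the two sides enters it; the other boundary path is treated in the same way
        with \<open>e b c\<close>.\<close>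
      have "\<exists>z\<in>X. near (e a z) \<or> near (e z f)"
      proof (cases "k \<le> lev (t (e a f)) \<and> anc (t (e a f)) k = ?m")
        case True
        then show ?thesis using cross[of "\<lambda>z. e a z" c f] g lip abcf root0 by blast
      next
        case False
        then show ?thesis using cross[of "\<lambda>z. e z f" a b] g lip abcf kq by blast
      qed
      then obtain z1 where z1: "z1 \<in> X" "near (e a z1) \<or> near (e z1 f)" by blast
      have "\<exists>z\<in>X. near (e z c) \<or> near (e b z)"
      proof (cases "k \<le> lev (t (e b c)) \<and> anc (t (e b c)) k = ?m")
        case True
        then show ?thesis using cross[of "\<lambda>z. e z c" a b] g lip abcf root0 by blast
      next
        case False
        then show ?thesis using cross[of "\<lambda>z. e b z" c f] g lip abcf kq by blast
      qed
      then obtain z2 where z2: "z2 \<in> X" "near (e z2 c) \<or> near (e b z2)" by blast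
      have nn: "d x y \<le> Q" if "near x" "near y" for x y
      proof -
        have "dT (t x) (t y) \<le> 2 * K"
          using dT_le_anc[of "t x" "t y" k] that by (simp add: near_def)
        then have "A * dT (t x) (t y) \<le> A * (2 * K)" using *(4) by (intro mult_left_mono) auto
        then show ?thesis using *(7)[of x y] that by (simp add: near_def Q_def)
      qed
      have close: "dT (t x) (t y) \<le> A * Q + A" if "x \<in> X" "y \<in> X" "d x y \<le> Q" for x y
      proof -
        have "A * d x y \<le> A * Q" using that *(4) by (intro mult_left_mono) auto
        then show ?thesis using *(6)[OF that(1,2)] by simp
      qed
      have half: "real (lev ?q) \<le> 2 * real k + 1" by (simp add: k_def)
      \<comment> \<open>Near points on opposite sides bound \<open>D1 a b\<close> or
        \<open>D2 c f\<close> by \<open>Q\<close>. If the sides meet in \<open>e a c\<close> or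
        \<open>e b f\<close>, this corner is within \<open>Q\<close> of a near point, so the halfway
        level is at most \<open>M\<close> and \<open>lq\<close> applies.\<close>
      consider "near (e a z1)" "near (e z2 c)" | "near (e a z1)" "near (e b z2)"
        | "near (e z1 f)" "near (e z2 c)" | "near (e z1 f)" "near (e b z2)"
        using z1 z2 by blast
      then show ?thesis
      proof cases
        case 1
        have "D1 a z2 + D2 z1 c \<le> Q" using nn[OF 1] de abcf z1 z2 by simp
        then have "d (e a c) (e a z1) \<le> Q"
          using D[of a z2] X.commute[of "e a c" "e a z1"] de abcf z1 z2 Dself by simp
        then have "real (lev (t (e a z1))) \<le> A * Q + A"
          using close[of "e a c" "e a z1"] e abcf z1 by (simp add: dT_root)
        then have "real k \<le> M" using 1 K0 by (simp add: near_def M_def)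
        then show ?thesis using half lq by simp
      next
        case 2
        then have "D1 a b + D2 z1 z2 \<le> Q" using nn[OF 2] de abcf z1 z2 by simp
        then show ?thesis using D[of z1 z2] z1 z2 by (auto simp: R_def)
      next
        case 3
        then have "D1 z2 z1 + D2 c f \<le> Q" using nn[OF 3(2,1)] de abcf z1 z2 by simp
        then show ?thesis using D[of z2 z1] z1 z2 by (auto simp: R_def)
      next
        case 4
        have "D1 z1 b + D2 f z2 \<le> Q" using nn[OF 4] de abcf z1 z2 by simp
        then have "d (e b f) (e z1 f) \<le> Q"
          using D[of f z2] X.commute[of "e b f" "e z1 f"] de abcf z1 z2 Dself by simp
        then have "dT ?q (t (e z1 f)) \<le> A * Q + A"
          using close[of "e b f" "e z1 f"] e abcf z1 by simp
        then have "real (lev ?q) \<le> real (lev (t (e z1 f))) + (A * Q + A)"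
          using lev_lipschitz[of ?q "t (e z1 f)"] e abcf z1 by simp
        then have "real (lev ?q) \<le> real k + M" using 4 by (simp add: near_def M_def)
        moreover have "2 * real k \<le> real (lev ?q)" by (simp add: k_def)
        ultimately show ?thesis using lq by simp
      qed
    qed
  qed
  have "small_squares X d R"
    unfolding small_squares_def
  proof (intro allI impI ballI)
    fix e D1 D2 a b c f
    assume "\<forall>z\<in>X. \<forall>w\<in>X. e z w \<in> X"
      "\<forall>z\<in>X. \<forall>w\<in>X. \<forall>z'\<in>X. \<forall>w'\<in>X. d (e z w) (e z' w') = D1 z z' + D2 w w'"
      "\<forall>z\<in>X. \<forall>w\<in>X. 0 \<le> D1 z w \<and> D1 z w \<le> d z w \<and> 0 \<le> D2 z w \<and> D2 z w \<le> d z w"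
      "a \<in> X" "b \<in> X" "c \<in> X" "f \<in> X"
    then show "D1 a b \<le> R \<or> D2 c f \<le> R" by (intro small[of e D1 D2 a b c f]) auto
  qed
  then show ?thesis by blast
qed

text \<open>The chart turns coarse steps along \<open>F\<close> into bounded steps in the tree,
  where \<open>ancestor_system_of_tree_map\<close> applies with root \<open>t (F b)\<close>;
  \<open>c\<close> absorbs the constants of both.\<close>

lemma ancestor_system_of_quasi_tree:
  assumes qt: "quasi_tree TYPE('v) X d" and F: "F \<in> M \<rightarrow> X" and b: "b \<in> M"
    and chain: "\<And>g. g \<in> M \<Longrightarrow> (\<lambda>u v. u \<in> M \<and> v \<in> M \<and> d (F u) (F v) \<le> K)\<^sup>*\<^sup>* b g"
  obtains A c where "c \<ge> 1" "ancestor_system M b A"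
    "\<And>g h. g \<in> M \<Longrightarrow> h \<in> M \<Longrightarrow> real (card (symdiff (A g) (A h))) \<le> c * d (F g) (F h) + c"
    "\<And>g h. g \<in> M \<Longrightarrow> h \<in> M \<Longrightarrow> d (F g) (F h) \<le> c * real (card (symdiff (A g) (A h))) + c"
proof -
  obtain V :: "'v set" and E t a C where "quasi_tree_chart X d V E t a C"
    using quasi_tree_has_chart[OF qt] by blast
  then interpret X: quasi_tree_chart X d V E t a C .
  note * = X.Metric_space_axioms X.tree X.t_in X.A_ge_1 X.C_pos X.upper X.lower X.dense
  have F_in [simp]: "g \<in> M \<Longrightarrow> F g \<in> X" and t_in [simp]: "x \<in> X \<Longrightarrow> t x \<in> V" for g x
    using F *(3) by auto
  interpret rooted_tree V E "t (F b)" using *(2) b by unfold_locales auto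
  define k where "k = nat \<lceil>a * K + a\<rceil>"
  have "dT (t (F u)) (t (F v)) \<le> k" if "u \<in> M" "v \<in> M" "d (F u) (F v) \<le> K" for u v
  proof -
    have "a * d (F u) (F v) \<le> a * K" using that *(4) by (intro mult_left_mono) auto
    then have "dT (t (F u)) (t (F v)) \<le> a * K + a" using *(6)[of "F u" "F v"] that by simp
    then show ?thesis unfolding k_def by linarith
  qed
  then have "(\<lambda>u v. u \<in> M \<and> v \<in> M \<and> dT (t (F u)) (t (F v)) \<le> k)\<^sup>*\<^sup>* b g" if "g \<in> M" for g
    using rtranclp_mono[of "\<lambda>u v. u \<in> M \<and> v \<in> M \<and> d (F u) (F v) \<le> K"
      "\<lambda>u v. u \<in> M \<and> v \<in> M \<and> dT (t (F u)) (t (F v)) \<le> k"] chain[OF that] by blast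
  from ancestor_system_of_tree_map[of "\<lambda>g. t (F g)" M b k, OF _ b refl this]
  obtain A where A: "ancestor_system M b A"
    "\<And>g h. g \<in> M \<Longrightarrow> h \<in> M \<Longrightarrow> real (card (symdiff (A g) (A h))) \<le> dT (t (F g)) (t (F h)) + 4"
    "\<And>g h. g \<in> M \<Longrightarrow> h \<in> M \<Longrightarrow>
      dT (t (F g)) (t (F h)) \<le> Suc k * (real (card (symdiff (A g) (A h))) + 4)"
    by auto
  define c where "c = a * Suc k + a * Suc k * 4 + a * a + 4"
  have ak: "a * Suc k \<ge> 0" "a * a \<ge> 0" using *(4) by auto
  have "1 * a \<le> a * a" using *(4) by (intro mult_right_mono) auto
  then have c: "c \<ge> a + 4" "c \<ge> a * Suc k" "c \<ge> a * Suc k * 4 + a * a"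
    using *(4) ak by (simp_all only: c_def)
  show thesis
  proof (rule that[OF _ A(1)])
    show "c \<ge> 1" using c(1) *(4) by simp
    fix g h assume gh: "g \<in> M" "h \<in> M"
    let ?D = "real (card (symdiff (A g) (A h)))"
    have "a * d (F g) (F h) \<le> c * d (F g) (F h)" using c *(4) by (intro mult_right_mono) auto
    then show "?D \<le> c * d (F g) (F h) + c"
      using A(2)[OF gh] *(6)[of "F g" "F h"] gh c(1) by simp
    have "a * dT (t (F g)) (t (F h)) \<le> a * (Suc k * (?D + 4))"
      using A(3)[OF gh] *(4) by (intro mult_left_mono) auto
    also have "\<dots> = (a * Suc k) * ?D + a * Suc k * 4" by (simp add: algebra_simps)
    also have "\<dots> \<le> c * ?D + a * Suc k * 4" using c(2) by (intro add_right_mono mult_right_mono) auto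
    finally show "d (F g) (F h) \<le> c * ?D + c" using *(7)[of "F g" "F h"] gh c(3) by simp
  qed
qed

section \<open>Linearising families of trees\<close>

lift_definition basis_ell1 :: "nat \<Rightarrow> ell1" is "\<lambda>n k. if k = n then 1 else 0"
proof -
  fix n :: nat
  show "summable (\<lambda>k. \<bar>(if k = n then 1 else 0) :: real\<bar>)"
    by (rule summable_finite[of "{n}"]) auto
qed

definition ind_ell1 :: "nat set \<Rightarrow> ell1" where
  "ind_ell1 S = sum basis_ell1 S"

lemma nth_zero [simp]: "ell1_nth 0 k = 0"
  and nth_add [simp]: "ell1_nth (x + y) k = ell1_nth x k + ell1_nth y k"
  and nth_diff [simp]: "ell1_nth (x - y) k = ell1_nth x k - ell1_nth y k"
  and nth_scaleR [simp]: "ell1_nth (c *\<^sub>R x) k = c * ell1_nth x k"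
  and nth_basis [simp]: "ell1_nth (basis_ell1 n) k = (if k = n then 1 else 0)"
  by (simp_all add: zero_ell1.rep_eq plus_ell1.rep_eq minus_ell1.rep_eq scaleR_ell1.rep_eq
      basis_ell1.rep_eq)

lemma nth_sum [simp]: "ell1_nth (sum f S) k = (\<Sum>x\<in>S. ell1_nth (f x) k)"
  by (induction S rule: infinite_finite_induct) simp_all

lemma nth_ind: "finite S \<Longrightarrow> ell1_nth (ind_ell1 S) k = of_bool (k \<in> S)"
  by (simp add: ind_ell1_def)

lemma norm_ind_diff:
  assumes "finite S" "finite T"
  shows "norm (ind_ell1 S - ind_ell1 T) = card (symdiff S T)"
proof -
  have "norm (ind_ell1 S - ind_ell1 T) = (\<Sum>k. of_bool (k \<in> symdiff S T) :: real)"
    unfolding norm_ell1.rep_eq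
    by (intro suminf_cong) (auto simp: nth_ind assms symdiff_def)
  also have "\<dots> = (\<Sum>k\<in>symdiff S T. of_bool (k \<in> symdiff S T))"
    using assms by (intro suminf_finite) (auto simp: symdiff_def)
  also have "\<dots> = card (symdiff S T)" by simp
  finally show ?thesis .
qed

lemma norm_basis [simp]: "norm (basis_ell1 n) = 1"
  using norm_ind_diff[of "{n}" "{}"] by (simp add: ind_ell1_def symdiff_def)

lemma basis_expansion: "(\<lambda>n. ell1_nth x n *\<^sub>R basis_ell1 n) sums x"
proof -
  let ?S = "\<lambda>m. \<Sum>n<m. ell1_nth x n *\<^sub>R basis_ell1 n"
  have nth_S: "ell1_nth (?S m) k = (if k < m then ell1_nth x k else 0)" for m k
    by (simp add: mult_delta_right)
  \<comment> \<open>The remainder vanishes below \<open>m\<close> and is \<open>- x\<close> from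
    there on, so its norm is a tail of a convergent series.\<close>
  have "norm (?S m - x) = (\<Sum>k. \<bar>ell1_nth x k\<bar>) - (\<Sum>k<m. \<bar>ell1_nth x k\<bar>)" for m
  proof -
    have "norm (?S m - x) = (\<Sum>k. \<bar>ell1_nth x k\<bar> - (if k \<in> {..<m} then \<bar>ell1_nth x k\<bar> else 0))"
      unfolding norm_ell1.rep_eq by (intro suminf_cong) (simp add: nth_S del: nth_sum)
    also have "\<dots> = (\<Sum>k. \<bar>ell1_nth x k\<bar>) - (\<Sum>k. if k \<in> {..<m} then \<bar>ell1_nth x k\<bar> else 0)"
      by (rule suminf_diff[OF summable_ell1 sums_summable[OF sums_If_finite_set], symmetric]) simp
    also have "(\<Sum>k. if k \<in> {..<m} then \<bar>ell1_nth x k\<bar> else 0) = (\<Sum>k<m. \<bar>ell1_nth x k\<bar>)"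
      using sums_If_finite_set[of "{..<m}" "\<lambda>k. \<bar>ell1_nth x k\<bar>"] by (simp add: sums_iff)
    finally show ?thesis .
  qed
  moreover have "(\<lambda>m. (\<Sum>k. \<bar>ell1_nth x k\<bar>) - (\<Sum>k<m. \<bar>ell1_nth x k\<bar>)) \<longlonglongrightarrow>
      (\<Sum>k. \<bar>ell1_nth x k\<bar>) - (\<Sum>k. \<bar>ell1_nth x k\<bar>)"
    by (intro tendsto_diff tendsto_const summable_LIMSEQ summable_ell1)
  ultimately have "(\<lambda>m. norm (?S m - x)) \<longlonglongrightarrow> 0" by simp
  then show ?thesis unfolding sums_def by (rule LIM_zero_cancel[OF tendsto_norm_zero_cancel])
qed

lemma blinfun_ell1_eqI:
  fixes S T :: "ell1 \<Rightarrow>\<^sub>L 'b::real_normed_vector"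
  assumes "\<And>n. blinfun_apply S (basis_ell1 n) = blinfun_apply T (basis_ell1 n)"
  shows "S = T"
proof (rule blinfun_eqI)
  fix x
  note sums = bounded_linear.sums[OF blinfun.bounded_linear_right basis_expansion[of x]]
  show "blinfun_apply S x = blinfun_apply T x"
    by (rule sums_unique2[OF sums[of S]]) (use sums[of T] in \<open>simp add: blinfun.scaleR_right assms\<close>)
qed

text \<open>The series that defines the operator is dominated by
  \<open>\<bar>ell1_nth x n\<bar> * C\<close>, whose sum is \<open>norm x * C\<close>; so no
  constant is lost.\<close>

lemma blinfun_ell1_extension:
  fixes w :: "nat \<Rightarrow> 'b::banach"
  assumes w: "\<And>n. norm (w n) \<le> C"
  shows "\<exists>T :: ell1 \<Rightarrow>\<^sub>L 'b. (\<forall>n. blinfun_apply T (basis_ell1 n) = w n) \<and> norm T \<le> C"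
proof -
  have C: "C \<ge> 0" using w[of 0] norm_ge_zero order_trans by blast
  have bound: "norm (ell1_nth x n *\<^sub>R w n) \<le> \<bar>ell1_nth x n\<bar> * C" for x n
    using w[of n] by (simp add: mult_left_mono)
  have dom: "summable (\<lambda>n. \<bar>ell1_nth x n\<bar> * C)" for x
    by (intro summable_mult2 summable_ell1)
  have sn: "summable (\<lambda>n. norm (ell1_nth x n *\<^sub>R w n))" for x
    by (rule summable_comparison_test'[OF dom, of 0]) (use bound in simp)
  note s = summable_norm_cancel[OF sn]
  define f where "f x = (\<Sum>n. ell1_nth x n *\<^sub>R w n)" for x
  have norm_f: "norm (f x) \<le> norm x * C" for x
  proof -
    have "norm (f x) \<le> (\<Sum>n. norm (ell1_nth x n *\<^sub>R w n))"
      unfolding f_def by (rule summable_norm[OF sn])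
    also have "\<dots> \<le> (\<Sum>n. \<bar>ell1_nth x n\<bar> * C)" by (rule suminf_le[OF bound sn dom])
    also have "\<dots> = norm x * C"
      unfolding norm_ell1.rep_eq by (rule suminf_mult2[OF summable_ell1, symmetric])
    finally show ?thesis .
  qed
  have "bounded_linear f"
  proof (rule bounded_linear_intro)
    show "f (x + y) = f x + f y" for x y
      unfolding f_def using suminf_add[OF s s, of x y] by (simp add: scaleR_add_left)
    show "f (c *\<^sub>R x) = c *\<^sub>R f x" for c x
      unfolding f_def using suminf_scaleR_right[OF s, of c x] by simp
  qed (rule norm_f)
  then have f: "blinfun_apply (Blinfun f) = f" by (rule bounded_linear_Blinfun_apply)
  have "f (basis_ell1 n) = w n" for n
    unfolding f_def using suminf_finite[of "{n}" "\<lambda>k. ell1_nth (basis_ell1 n) k *\<^sub>R w k"] by simp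
  moreover have "norm (Blinfun f) \<le> C"
    using norm_f C by (intro norm_blinfun_bound) (simp_all add: f mult.commute)
  ultimately show ?thesis using f by (intro exI[of _ "Blinfun f"]) simp
qed

section \<open>The affine action of a permuted family of trees\<close>

lemma symdiff_image:
  assumes "inj_on f C" "A \<subseteq> C" "B \<subseteq> C"
  shows "symdiff (f ` A) (f ` B) = f ` symdiff A B"
proof -
  have "A - B \<subseteq> C" "B - A \<subseteq> C" using assms by auto
  then show ?thesis
    using inj_on_image_set_diff[of f C A B] inj_on_image_set_diff[of f C B A] assms
    by (simp add: symdiff_def image_Un)
qed

lemma ancestor_systemD:
  assumes "ancestor_system M b A"
  shows "A b = {}" "g \<in> M \<Longrightarrow> finite (A g)" "g \<in> M \<Longrightarrow> A g \<subseteq> M - {b}"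
    "g \<in> M - {b} \<Longrightarrow> \<exists>p\<in>M. A g = insert g (A p) \<and> g \<notin> A p"
  using assms by (auto simp: ancestor_system_def)

text \<open>With basis vectors standing for the edges of the trees, the difference of \<open>v i g\<close> and \<open>v i h\<close> below
  is the path from \<open>h\<close> to \<open>g\<close>; it is mapped to the path from the translate of \<open>h\<close> to that of \<open>g\<close>.
  On \<open>\<ell>\<^sup>1\<close> it suffices to bound the images of the edges. The enumeration of the edges need not be onto
  the natural numbers, and the remaining basis vectors are fixed.\<close>

lemma affine_action_of_ancestor_systems:
  fixes G :: "('g, 'm) monoid_scheme" (structure) and A :: "'i \<Rightarrow> 'g \<Rightarrow> 'g set"
  assumes G: "group G" and cnt: "countable (carrier G)" and I: "finite I"
    and A: "\<And>i. i \<in> I \<Longrightarrow> ancestor_system (carrier G) \<one> (A i)"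
    and \<sigma>: "\<And>s. s \<in> carrier G \<Longrightarrow> bij_betw (\<sigma> s) I I"
    and \<sigma>_one: "\<And>i. i \<in> I \<Longrightarrow> \<sigma> \<one> i = i"
    and \<sigma>_mult: "\<And>s t i. \<lbrakk>s \<in> carrier G; t \<in> carrier G; i \<in> I\<rbrakk> \<Longrightarrow> \<sigma> (s \<otimes> t) i = \<sigma> s (\<sigma> t i)"
    and bound: "\<And>s i g h. \<lbrakk>s \<in> carrier G; i \<in> I; g \<in> carrier G; h \<in> carrier G;
      card (symdiff (A i g) (A i h)) = 1\<rbrakk> \<Longrightarrow>
      real (card (symdiff (A (\<sigma> s i) (s \<otimes> g)) (A (\<sigma> s i) (s \<otimes> h)))) \<le> L"
  obtains \<pi> :: "'g \<Rightarrow> ell1 \<Rightarrow>\<^sub>L ell1" and b where "affine_action G \<pi> b" "uniformly_lipschitz G \<pi>"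
    "\<And>s t. \<lbrakk>s \<in> carrier G; t \<in> carrier G\<rbrakk> \<Longrightarrow>
      dist (b s) (b t) = (\<Sum>i\<in>I. real (card (symdiff (A i s) (A i t))))"
proof -
  interpret group G by fact
  note A_one = ancestor_systemD(1)[OF A] and A_fin = ancestor_systemD(2)[OF A]
    and A_sub = ancestor_systemD(3)[OF A] and A_par = ancestor_systemD(4)[OF A]
  \<comment> \<open>For \<open>g\<close> other than \<open>\<one>\<close> the pair
    \<open>(i, g)\<close> names the edge from \<open>g\<close> to its parent in tree
    \<open>i\<close>. The pairs \<open>(i, \<one>)\<close> name no edge and are left out of
    \<open>W\<close>.\<close>
  define \<iota> where "\<iota> = to_nat_on (I \<times> carrier G)"
  have inj: "inj_on \<iota> (I \<times> carrier G)"
    unfolding \<iota>_def using cnt I by (intro inj_on_to_nat_on countable_SIGMA) (auto intro: countable_finite)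
  define p where "p i g = (SOME p. p \<in> carrier G \<and> A i g = insert g (A i p) \<and> g \<notin> A i p)" for i g
  have p: "p i g \<in> carrier G" "A i g = insert g (A i (p i g))" "g \<notin> A i (p i g)"
    if "i \<in> I" "g \<in> carrier G - {\<one>}" for i g
    using someI_ex[OF A_par[OF that, unfolded Bex_def]] by (simp_all add: p_def)
  define v where "v i g = ind_ell1 (\<iota> ` ({i} \<times> A i g))" for i g
  have inj_i: "inj_on \<iota> ({i} \<times> S)" if "i \<in> I" "S \<subseteq> carrier G" for i S
    using inj by (rule inj_on_subset) (use that in auto)
  have v_sum: "v i g = (\<Sum>h\<in>A i g. basis_ell1 (\<iota> (i, h)))" if "i \<in> I" "g \<in> carrier G" for i g
  proof -
    have "A i g \<subseteq> carrier G" using A_sub[OF that] by blast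
    then have "v i g = (\<Sum>x\<in>{i} \<times> A i g. basis_ell1 (\<iota> x))"
      unfolding v_def ind_ell1_def by (intro sum.reindex[unfolded o_def] inj_i that)
    also have "{i} \<times> A i g = Pair i ` A i g" by auto
    finally show ?thesis by (simp add: sum.reindex inj_on_def)
  qed
  have v_one: "v i \<one> = 0" if "i \<in> I" for i
    using A_one[OF that] by (simp add: v_def ind_ell1_def)
  have v_par: "v i g = basis_ell1 (\<iota> (i, g)) + v i (p i g)" if "i \<in> I" "g \<in> carrier G - {\<one>}" for i g
    using p[OF that] v_sum[OF that(1), of g] v_sum[OF that(1), of "p i g"] that A_fin[OF that(1)] by simp
  have norm_v: "norm (v i g - v i h) = card (symdiff (A i g) (A i h))"
    if "i \<in> I" "g \<in> carrier G" "h \<in> carrier G" for i g h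
  proof -
    have sub: "A i g \<union> A i h \<subseteq> carrier G" using A_sub[OF that(1)] that by blast
    have "symdiff ({i} \<times> A i g) ({i} \<times> A i h) = {i} \<times> symdiff (A i g) (A i h)"
      by (auto simp: symdiff_def)
    then have "symdiff (\<iota> ` ({i} \<times> A i g)) (\<iota> ` ({i} \<times> A i h)) = \<iota> ` ({i} \<times> symdiff (A i g) (A i h))"
      using symdiff_image[OF inj_i[OF that(1) order_refl], of "{i} \<times> A i g" "{i} \<times> A i h"] sub
      by auto
    moreover have "card (\<iota> ` ({i} \<times> symdiff (A i g) (A i h))) = card (symdiff (A i g) (A i h))"
      using sub by (subst card_image[OF inj_i[OF that(1)]]) (auto simp: symdiff_def card_cartesian_product_singleton)
    ultimately show ?thesis unfolding v_def using A_fin that by (simp add: norm_ind_diff)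
  qed
  define W where "W = \<iota> ` (I \<times> (carrier G - {\<one>}))"
  define w where "w s n = (if n \<in> W then (case inv_into (I \<times> carrier G) \<iota> n of (i, g) \<Rightarrow>
      v (\<sigma> s i) (s \<otimes> g) - v (\<sigma> s i) (s \<otimes> p i g)) else basis_ell1 n)" for s n
  have w_edge: "w s (\<iota> (i, g)) = v (\<sigma> s i) (s \<otimes> g) - v (\<sigma> s i) (s \<otimes> p i g)"
    if "i \<in> I" "g \<in> carrier G - {\<one>}" for s i g
    using that inv_into_f_f[OF inj, of "(i, g)"] by (auto simp: w_def W_def)
  have \<sigma>_in: "\<sigma> s i \<in> I" if "s \<in> carrier G" "i \<in> I" for s i
    using \<sigma>[OF that(1)] that(2) by (auto simp: bij_betw_def)
  have w_bound: "norm (w s n) \<le> max 1 L" if s: "s \<in> carrier G" for s n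
  proof (cases "n \<in> W")
    case True
    then obtain i g where ig: "n = \<iota> (i, g)" "i \<in> I" "g \<in> carrier G - {\<one>}" by (auto simp: W_def)
    note p = p[OF ig(2,3)]
    \<comment> \<open>The ends of an edge differ by one ancestor, which is the case covered by
      \<open>bound\<close>.\<close>
    have "symdiff (A i g) (A i (p i g)) = {g}" using p by (auto simp: symdiff_def)
    then have "real (card (symdiff (A (\<sigma> s i) (s \<otimes> g)) (A (\<sigma> s i) (s \<otimes> p i g)))) \<le> L"
      using bound[OF s ig(2), of g "p i g"] p(1) ig(3) by simp
    then show ?thesis
      using norm_v[OF \<sigma>_in[OF s ig(2)], of "s \<otimes> g" "s \<otimes> p i g"] w_edge[OF ig(2,3)] ig p(1) s by simp
  qed (simp add: w_def)
  define \<pi> :: "'g \<Rightarrow> ell1 \<Rightarrow>\<^sub>L ell1" where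
    "\<pi> s = (SOME T. (\<forall>n. blinfun_apply T (basis_ell1 n) = w s n) \<and> norm T \<le> max 1 L)" for s
  have \<pi>: "blinfun_apply (\<pi> s) (basis_ell1 n) = w s n" "norm (\<pi> s) \<le> max 1 L"
    if s: "s \<in> carrier G" for s n
  proof -
    have "\<exists>T :: ell1 \<Rightarrow>\<^sub>L ell1. (\<forall>n. blinfun_apply T (basis_ell1 n) = w s n) \<and> norm T \<le> max 1 L"
      by (rule blinfun_ell1_extension) (rule w_bound[OF s])
    from someI_ex[OF this]
    show "blinfun_apply (\<pi> s) (basis_ell1 n) = w s n" "norm (\<pi> s) \<le> max 1 L"
      by (simp_all add: \<pi>_def)
  qed
  \<comment> \<open>The images of the edges telescope along the path from \<open>g\<close> to the
    root; \<open>v (\<sigma> s i) s\<close> remains because \<open>s\<close> translates the root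
    \<open>\<one>\<close> to \<open>s\<close>.\<close>
  have \<pi>_v: "blinfun_apply (\<pi> s) (v i g) = v (\<sigma> s i) (s \<otimes> g) - v (\<sigma> s i) s"
    if s: "s \<in> carrier G" and i: "i \<in> I" and "g \<in> carrier G" for s i g
    using that(3)
  proof (induction "card (A i g)" arbitrary: g rule: less_induct)
    case less
    show ?case
    proof (cases "g = \<one>")
      case True
      then show ?thesis using v_one[OF i] s by simp
    next
      case False
      then have g: "g \<in> carrier G - {\<one>}" using less.prems by simp
      note p = p[OF i g]
      have "card (A i (p i g)) < card (A i g)"
        using p A_fin[OF i p(1)] by simp
      from less.hyps[OF this p(1)] show ?thesis
        using v_par[OF i g] \<pi>(1)[OF s] w_edge[OF i g] by (simp add: blinfun.add_right)
    qed
  qed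
  have \<pi>_fix: "blinfun_apply (\<pi> s) (basis_ell1 n) = basis_ell1 n" if "s \<in> carrier G" "n \<notin> W" for s n
    using \<pi>(1)[OF that(1)] that(2) by (simp add: w_def)
  have edge: "\<exists>i g. n = \<iota> (i, g) \<and> i \<in> I \<and> g \<in> carrier G - {\<one>}" if "n \<in> W" for n
    using that by (auto simp: W_def)
  have \<pi>_one: "\<pi> \<one> = id_blinfun"
  proof (rule blinfun_ell1_eqI)
    fix n
    show "blinfun_apply (\<pi> \<one>) (basis_ell1 n) = blinfun_apply id_blinfun (basis_ell1 n)"
    proof (cases "n \<in> W")
      case True
      then obtain i g where ig: "n = \<iota> (i, g)" "i \<in> I" "g \<in> carrier G - {\<one>}" using edge by blast
      then show ?thesis
        using \<pi>(1)[of \<one>] w_edge[OF ig(2,3)] v_par[OF ig(2,3)] \<sigma>_one p(1)[OF ig(2,3)] by simp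
    qed (simp add: \<pi>_fix)
  qed
  have \<pi>_mult: "\<pi> (s \<otimes> t) = \<pi> s o\<^sub>L \<pi> t" if st: "s \<in> carrier G" "t \<in> carrier G" for s t
  proof (rule blinfun_ell1_eqI)
    fix n
    show "blinfun_apply (\<pi> (s \<otimes> t)) (basis_ell1 n) = blinfun_apply (\<pi> s o\<^sub>L \<pi> t) (basis_ell1 n)"
    proof (cases "n \<in> W")
      case True
      then obtain i g where ig: "n = \<iota> (i, g)" "i \<in> I" "g \<in> carrier G - {\<one>}" using edge by blast
      note p = p(1)[OF ig(2,3)]
      have "blinfun_apply (\<pi> t) (basis_ell1 n) = v (\<sigma> t i) (t \<otimes> g) - v (\<sigma> t i) (t \<otimes> p i g)"
        using \<pi>(1)[OF st(2)] w_edge[OF ig(2,3)] ig(1) by simp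
      \<comment> \<open>The terms that \<open>\<pi>_v\<close> contributes for the translated root
        cancel in the difference and leave the image of the edge under
        \<open>s \<otimes> t\<close>.\<close>
      then show ?thesis
        using \<pi>(1)[of "s \<otimes> t"] w_edge[OF ig(2,3)] \<pi>_v[OF st(1) \<sigma>_in[OF st(2) ig(2)]] st ig p
          \<sigma>_mult[OF st ig(2)] by (simp add: blinfun.diff_right m_assoc)
    qed (use st in \<open>simp add: \<pi>_fix\<close>)
  qed
  have GL: "\<pi> s \<in> carrier GL" if s: "s \<in> carrier G" for s
    using \<pi>_mult[of s "inv s"] \<pi>_mult[of "inv s" s] s
    by (auto simp: carrier_GL \<pi>_one intro!: exI[of _ "\<pi> (inv s)"])
  define b where "b s = (\<Sum>i\<in>I. v i s)" for s
  have "affine_action G \<pi> b"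
    unfolding affine_action_def
  proof (intro conjI ballI)
    show "\<pi> \<in> hom G GL"
      using GL \<pi>_mult by (auto simp: hom_def GL_def units_of_def bounded_operators_def)
    fix s t assume st: "s \<in> carrier G" "t \<in> carrier G"
    have "blinfun_apply (\<pi> s) (b t) = (\<Sum>i\<in>I. v (\<sigma> s i) (s \<otimes> t) - v (\<sigma> s i) s)"
      unfolding b_def by (simp add: blinfun.sum_right \<pi>_v st)
    \<comment> \<open>As \<open>s\<close> may move one tree to another, only the sum over all of
      \<open>I\<close> is a cocycle: it is invariant under the permutation.\<close>
    also have "\<dots> = (\<Sum>i\<in>I. v i (s \<otimes> t) - v i s)"
      by (rule sum.reindex_bij_betw[OF \<sigma>[OF st(1)]])
    finally show "b (s \<otimes> t) = blinfun_apply (\<pi> s) (b t) + b s"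
      by (simp add: b_def sum_subtractf)
  qed
  moreover have "uniformly_lipschitz G \<pi>"
    unfolding uniformly_lipschitz_def by (rule bdd_aboveI2[where M = "max 1 L"]) (rule \<pi>(2))
  moreover have "dist (b s) (b t) = (\<Sum>i\<in>I. real (card (symdiff (A i s) (A i t))))"
    if st: "s \<in> carrier G" "t \<in> carrier G" for s t
  proof -
    \<comment> \<open>Edges of different trees are different basis vectors, so \<open>b s\<close> is
      again an indicator and the distances in the trees add up.\<close>
    have b_ind: "b s = ind_ell1 (\<iota> ` Sigma I (\<lambda>i. A i s))" if "s \<in> carrier G" for s
    proof -
      have sub: "Sigma I (\<lambda>i. A i s) \<subseteq> I \<times> carrier G" using A_sub that by blast
      have "b s = (\<Sum>i\<in>I. \<Sum>h\<in>A i s. basis_ell1 (\<iota> (i, h)))" by (simp add: b_def v_sum that)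
      also have "\<dots> = (\<Sum>x\<in>Sigma I (\<lambda>i. A i s). basis_ell1 (\<iota> x))"
        using I A_fin that by (subst sum.Sigma) auto
      finally show ?thesis
        unfolding ind_ell1_def using inj_on_subset[OF inj sub] by (simp add: sum.reindex)
    qed
    let ?S = "\<lambda>s. Sigma I (\<lambda>i. A i s)"
    have sub: "?S s \<union> ?S t \<subseteq> I \<times> carrier G" using A_sub st by blast
    have "symdiff (\<iota> ` ?S s) (\<iota> ` ?S t) = \<iota> ` Sigma I (\<lambda>i. symdiff (A i s) (A i t))"
    proof -
      have "symdiff (?S s) (?S t) = Sigma I (\<lambda>i. symdiff (A i s) (A i t))"
        by (auto simp: symdiff_def)
      then show ?thesis using symdiff_image[OF inj, of "?S s" "?S t"] sub by simp
    qed
    moreover have "card (\<iota> ` Sigma I (\<lambda>i. symdiff (A i s) (A i t))) =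
        card (Sigma I (\<lambda>i. symdiff (A i s) (A i t)))"
      using sub by (intro card_image inj_on_subset[OF inj]) (auto simp: symdiff_def)
    moreover have "\<dots> = (\<Sum>i\<in>I. card (symdiff (A i s) (A i t)))"
      using I A_fin st by (intro card_SigmaI) (auto simp: symdiff_def)
    moreover have "finite (\<iota> ` ?S s)" "finite (\<iota> ` ?S t)" using I A_fin st by auto
    ultimately show ?thesis using b_ind st by (simp add: dist_norm norm_ind_diff)
  qed
  ultimately show thesis by (rule that)
qed

section \<open>Word metrics and orbits\<close>

locale generated_group = group G for G (structure) +
  fixes S
  assumes gen: "finite_generating_set G S"
begin

abbreviation letters :: "'a set" where "letters \<equiv> S \<union> (\<lambda>s. inv s) ` S"

definition eval_word :: "'a list \<Rightarrow> 'a" where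
  "eval_word w = foldr (\<otimes>) w \<one>"

lemma eval_simps [simp]: "eval_word [] = \<one>" "eval_word (x # w) = x \<otimes> eval_word w"
  by (simp_all add: eval_word_def)

lemma letters_carrier: "letters \<subseteq> carrier G"
  using gen by (auto simp: finite_generating_set_def)

lemma eval_closed [simp]: "set w \<subseteq> letters \<Longrightarrow> eval_word w \<in> carrier G"
  using letters_carrier by (induction w) auto

lemma eval_append:
  "set w \<subseteq> letters \<Longrightarrow> set w' \<subseteq> letters \<Longrightarrow> eval_word (w @ w') = eval_word w \<otimes> eval_word w'"
  using letters_carrier by (induction w) (auto simp: m_assoc)

lemma word_exists:
  assumes "g \<in> carrier G"
  shows "\<exists>w. set w \<subseteq> letters \<and> eval_word w = g"
proof -
  have "g \<in> generate G S" using assms gen by (simp add: finite_generating_set_def)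
  then show ?thesis
  proof (induction rule: generate.induct)
    case one
    then show ?case by (intro exI[of _ "[]"]) simp
  next
    case (incl h)
    then show ?case using letters_carrier by (intro exI[of _ "[h]"]) auto
  next
    case (inv h)
    then show ?case using letters_carrier by (intro exI[of _ "[inv h]"]) auto
  next
    case (eng h1 h2)
    then obtain w1 w2 where "set w1 \<subseteq> letters" "eval_word w1 = h1" "set w2 \<subseteq> letters" "eval_word w2 = h2"
      by blast
    then show ?case using eval_append[of w1 w2] by (intro exI[of _ "w1 @ w2"]) auto
  qed
qed

lemma word_length_Least: "word_length G S g = (LEAST n. \<exists>w. length w = n \<and> set w \<subseteq> letters \<and> eval_word w = g)"
  by (simp add: word_length_def eval_word_def)

lemma word_length_attained:
  assumes "g \<in> carrier G"
  obtains w where "length w = word_length G S g" "set w \<subseteq> letters" "eval_word w = g"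
proof -
  have "\<exists>n w. length w = n \<and> set w \<subseteq> letters \<and> eval_word w = g" using word_exists[OF assms] by simp
  from LeastI_ex[OF this] show thesis using that unfolding word_length_Least by blast
qed

lemma word_length_le: "set w \<subseteq> letters \<Longrightarrow> word_length G S (eval_word w) \<le> length w"
  unfolding word_length_Least by (rule Least_le) auto

lemma word_length_mult:
  assumes "g \<in> carrier G" "h \<in> carrier G"
  shows "word_length G S (g \<otimes> h) \<le> word_length G S g + word_length G S h"
proof -
  obtain v where v: "length v = word_length G S g" "set v \<subseteq> letters" "eval_word v = g"
    using word_length_attained[OF assms(1)] .
  obtain w where w: "length w = word_length G S h" "set w \<subseteq> letters" "eval_word w = h"
    using word_length_attained[OF assms(2)] .
  show ?thesis using word_length_le[of "v @ w"] eval_append[of v w] v w by simp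
qed

lemma finite_word_ball: "finite {g \<in> carrier G. word_length G S g \<le> n}"
proof (rule finite_subset)
  show "{g \<in> carrier G. word_length G S g \<le> n} \<subseteq> eval_word ` {w. set w \<subseteq> letters \<and> length w \<le> n}"
  proof
    fix g assume "g \<in> {g \<in> carrier G. word_length G S g \<le> n}"
    then obtain w where "length w = word_length G S g" "set w \<subseteq> letters" "eval_word w = g" "length w \<le> n"
      using word_length_attained[of g] by auto
    then show "g \<in> eval_word ` {w. set w \<subseteq> letters \<and> length w \<le> n}" by auto
  qed
  have "finite letters" using gen by (simp add: finite_generating_set_def)
  then show "finite (eval_word ` {w. set w \<subseteq> letters \<and> length w \<le> n})"
    by (intro finite_imageI finite_lists_length_le)
qed

lemma countable_carrier: "countable (carrier G)"
proof -
  have "carrier G = (\<Union>n. {g \<in> carrier G. word_length G S g \<le> n})" by auto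
  also have "countable \<dots>" using countable_finite[OF finite_word_ball] by (intro countable_UN) auto
  finally show ?thesis .
qed

lemma word_dist_step:
  assumes "g \<in> carrier G" "x \<in> letters"
  shows "word_dist G S g (g \<otimes> x) \<le> 1"
proof -
  have x: "x \<in> carrier G" using assms letters_carrier by blast
  then have "inv g \<otimes> (g \<otimes> x) = eval_word [x]" using assms by (simp flip: m_assoc)
  then show ?thesis using word_length_le[of "[x]"] assms by (simp add: word_dist_def)
qed

text \<open>Orbits inherit this coarse connectedness, on which the construction of the trees
  depends.\<close>

lemma word_chain:
  assumes "g \<in> carrier G"
  shows "(\<lambda>u v. u \<in> carrier G \<and> v \<in> carrier G \<and> word_dist G S u v \<le> 1)\<^sup>*\<^sup>* \<one> g"
proof -
  let ?R = "\<lambda>u v. u \<in> carrier G \<and> v \<in> carrier G \<and> word_dist G S u v \<le> 1"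
  have chain: "?R\<^sup>*\<^sup>* u (u \<otimes> eval_word w)" if "set w \<subseteq> letters" "u \<in> carrier G" for u w
    using that
  proof (induction w arbitrary: u)
    case (Cons x w)
    have x: "x \<in> carrier G" "x \<in> letters" using Cons.prems letters_carrier by auto
    have "?R u (u \<otimes> x)" using word_dist_step x Cons.prems by simp
    moreover have "?R\<^sup>*\<^sup>* (u \<otimes> x) (u \<otimes> x \<otimes> eval_word w)" using Cons x by simp
    moreover have "u \<otimes> x \<otimes> eval_word w = u \<otimes> eval_word (x # w)"
      using x Cons.prems by (simp add: m_assoc)
    ultimately show ?case using converse_rtranclp_into_rtranclp[of ?R u "u \<otimes> x"] by simp
  qed simp
  obtain w where "set w \<subseteq> letters" "eval_word w = g" using word_exists[OF assms] by blast
  then show ?thesis using chain[of w \<one>] assms by simp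
qed

end

section \<open>Change of generators and orbits of affine actions\<close>

lemma word_length_change:
  assumes "group G" "finite_generating_set G S" "finite_generating_set G T"
  shows "\<exists>K::nat. \<forall>g\<in>carrier G. word_length G T g \<le> K * word_length G S g"
proof -
  interpret S: generated_group G S
    using assms(1,2) by (simp add: generated_group_def generated_group_axioms_def)
  interpret T: generated_group G T
    using assms(1,3) by (simp add: generated_group_def generated_group_axioms_def)
  have fin: "finite S.letters" using assms(2) by (simp add: finite_generating_set_def)
  define K where "K = (\<Sum>x\<in>S.letters. word_length G T x)"
  have K: "word_length G T x \<le> K" if "x \<in> S.letters" for x
    unfolding K_def using that fin by (intro member_le_sum) auto
  have eval: "word_length G T (S.eval_word w) \<le> K * length w" if "set w \<subseteq> S.letters" for w
    using that
  proof (induction w)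
    case Nil
    then show ?case using T.word_length_le[of "[]"] by simp
  next
    case (Cons x w)
    then have "x \<in> carrier G" "word_length G T x \<le> K" "word_length G T (S.eval_word w) \<le> K * length w"
      using K S.letters_carrier by auto
    then show ?case using T.word_length_mult[of x "S.eval_word w"] Cons.prems by simp
  qed
  have "word_length G T g \<le> K * word_length G S g" if g: "g \<in> carrier G" for g
  proof -
    obtain w where "length w = word_length G S g" "set w \<subseteq> S.letters" "S.eval_word w = g"
      using S.word_length_attained[OF g] .
    then show ?thesis using eval[of w] by simp
  qed
  then show ?thesis by blast
qed

text \<open>Here the lower bound has no denominator and \<open>a\<close> may be any real number. The
  constant \<open>max 1 a\<close> works because \<open>A \<le> A * A\<close> absorbs the additive
  term.\<close>

lemma qi_embeddingI:
  assumes "\<And>x y. x \<in> X \<Longrightarrow> y \<in> X \<Longrightarrow> 0 \<le> dX x y \<and> 0 \<le> dY (f x) (f y)"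
    and "\<And>x y. x \<in> X \<Longrightarrow> y \<in> X \<Longrightarrow> dX x y \<le> a * dY (f x) (f y) + a"
    and "\<And>x y. x \<in> X \<Longrightarrow> y \<in> X \<Longrightarrow> dY (f x) (f y) \<le> a * dX x y + a"
  shows "qi_embedding X dX dY f"
proof -
  define A where "A = max 1 a"
  have A: "A \<ge> 1" "A \<ge> a" by (auto simp: A_def)
  have "(1 / A) * dX x y - A \<le> dY (f x) (f y) \<and> dY (f x) (f y) \<le> A * dX x y + A"
    if xy: "x \<in> X" "y \<in> X" for x y
  proof -
    have "a * dY (f x) (f y) \<le> A * dY (f x) (f y)" "a * dX x y \<le> A * dX x y"
      using A assms(1)[OF xy] by (auto intro: mult_right_mono)
    moreover have "A \<le> A * A" using mult_left_mono[of 1 A A] A by simp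
    ultimately have "dX x y \<le> A * dY (f x) (f y) + A * A" "dY (f x) (f y) \<le> A * dX x y + A"
      using assms(2,3)[OF xy] A by linarith+
    then show ?thesis using A(1) by (simp add: field_simps)
  qed
  then show ?thesis unfolding qi_embedding_def using A(1) by blast
qed

text \<open>An orbit differs from \<open>b\<close> by \<open>\<pi> s v\<close>, which is bounded in
  \<open>s\<close>, so it inherits the coarse geometry of the cocycle. Properness follows since
  balls of the word metric are finite.\<close>

lemma orbits_of_qi_cocycle:
  fixes G :: "('g, 'm) monoid_scheme" (structure) and \<pi> :: "'g \<Rightarrow> 'e::banach \<Rightarrow>\<^sub>L 'e"
  assumes G: "group G" and S: "finite_generating_set G S" and ul: "uniformly_lipschitz G \<pi>"
    and lower: "\<And>s t. \<lbrakk>s \<in> carrier G; t \<in> carrier G\<rbrakk> \<Longrightarrow> word_dist G S s t \<le> a * dist (b s) (b t) + a"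
    and upper: "\<And>s t. \<lbrakk>s \<in> carrier G; t \<in> carrier G\<rbrakk> \<Longrightarrow> dist (b s) (b t) \<le> a * word_dist G S s t + a"
  shows "proper_action G (affine_map \<pi> b)" "qi_embedded_orbits G (affine_map \<pi> b)"
proof -
  interpret group G by fact
  obtain B where B: "\<And>s. s \<in> carrier G \<Longrightarrow> norm (\<pi> s) \<le> B"
    using ul by (auto simp: uniformly_lipschitz_def bdd_above_def)
  have close: "\<bar>dist (affine_map \<pi> b s v) (affine_map \<pi> b t v) - dist (b s) (b t)\<bar> \<le> 2 * B * norm v"
    if st: "s \<in> carrier G" "t \<in> carrier G" for s t v
  proof -
    have "norm (blinfun_apply (\<pi> s) v) \<le> B * norm v" if "s \<in> carrier G" for s
      by (rule order_trans[OF norm_blinfun mult_right_mono[OF B[OF that] norm_ge_zero]])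
    then have "norm (blinfun_apply (\<pi> s) v) + norm (blinfun_apply (\<pi> t) v) \<le> 2 * B * norm v"
      using st by (smt (verit) distrib_right)
    moreover have "norm (blinfun_apply (\<pi> s) v - blinfun_apply (\<pi> t) v) \<le>
        norm (blinfun_apply (\<pi> s) v) + norm (blinfun_apply (\<pi> t) v)"
      by (rule norm_triangle_ineq4)
    moreover have "\<bar>dist (affine_map \<pi> b s v) (affine_map \<pi> b t v) - dist (b s) (b t)\<bar> \<le>
        norm (blinfun_apply (\<pi> s) v - blinfun_apply (\<pi> t) v)"
      using norm_triangle_ineq3[of "affine_map \<pi> b s v - affine_map \<pi> b t v" "b s - b t"]
      by (simp add: dist_norm affine_map_def algebra_simps)
    ultimately show ?thesis by linarith
  qed
  define a' where "a' = \<bar>a\<bar>"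
  have a': "a' \<ge> 0" "a \<le> a'" by (auto simp: a'_def)
  have lower': "word_dist G S s t \<le> a' * dist (b s) (b t) + a'"
    and upper': "dist (b s) (b t) \<le> a' * word_dist G S s t + a'"
    if "s \<in> carrier G" "t \<in> carrier G" for s t
  proof -
    have "a * dist (b s) (b t) \<le> a' * dist (b s) (b t)"
      "a * word_dist G S s t \<le> a' * word_dist G S s t"
      using a' by (auto intro!: mult_right_mono simp: word_dist_def)
    then show "word_dist G S s t \<le> a' * dist (b s) (b t) + a'"
      "dist (b s) (b t) \<le> a' * word_dist G S s t + a'"
      using lower[OF that] upper[OF that] a' by linarith+
  qed
  define c where "c v = 2 * \<bar>B\<bar> * norm v" for v :: 'e
  have c: "c v \<ge> 0" and close': "dist (b s) (b t) \<le> dist (affine_map \<pi> b s v) (affine_map \<pi> b t v) + c v"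
    "dist (affine_map \<pi> b s v) (affine_map \<pi> b t v) \<le> dist (b s) (b t) + c v"
    if "s \<in> carrier G" "t \<in> carrier G" for s t v
  proof -
    have "2 * B * norm v \<le> c v" unfolding c_def by (intro mult_right_mono) auto
    then show "dist (b s) (b t) \<le> dist (affine_map \<pi> b s v) (affine_map \<pi> b t v) + c v"
      "dist (affine_map \<pi> b s v) (affine_map \<pi> b t v) \<le> dist (b s) (b t) + c v"
      using close[OF that, of v] by auto
  qed (simp add: c_def)
  have low: "word_dist G S s t \<le> a' * dist (affine_map \<pi> b s v) (affine_map \<pi> b t v) + a' * c v + a'"
    if "s \<in> carrier G" "t \<in> carrier G" for s t v
    using mult_left_mono[OF close'(1)[OF that, of v] a'(1)] lower'[OF that] by (simp add: distrib_left)
  show "proper_action G (affine_map \<pi> b)"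
    unfolding proper_action_def
  proof (intro allI impI)
    fix v and r :: real assume "r > 0"
    \<comment> \<open>The estimates compare orbit points, so the distance from \<open>v\<close> to
      the orbit point of \<open>\<one>\<close> is added to the radius.\<close>
    define r' where "r' = r + norm (v - affine_map \<pi> b \<one> v)"
    define n where "n = nat \<lceil>a' * r' + a' * c v + a'\<rceil>"
    interpret generated_group G S
      using G S by (simp add: generated_group_def generated_group_axioms_def)
    have "word_length G S s \<le> n" if s: "s \<in> carrier G" "norm (affine_map \<pi> b s v - v) \<le> r" for s
    proof -
      have "dist (affine_map \<pi> b \<one> v) (affine_map \<pi> b s v) \<le> r'"
        using dist_triangle[of "affine_map \<pi> b \<one> v" "affine_map \<pi> b s v" v] s(2)
        by (simp add: r'_def dist_norm norm_minus_commute)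
      then have "word_dist G S \<one> s \<le> a' * r' + a' * c v + a'"
        using low[of \<one> s v] s(1) a'(1) mult_left_mono by (smt (verit) one_closed)
      moreover have "word_dist G S \<one> s = real (word_length G S s)" using s(1) by (simp add: word_dist_def)
      ultimately show ?thesis unfolding n_def by linarith
    qed
    then show "finite {s \<in> carrier G. norm (affine_map \<pi> b s v - v) \<le> r}"
      by (intro finite_subset[OF _ finite_word_ball[of n]]) auto
  qed
  show "qi_embedded_orbits G (affine_map \<pi> b)"
    unfolding qi_embedded_orbits_def
  proof (intro allI impI)
    fix T v assume T: "finite_generating_set G T"
    obtain K1 :: nat where K1: "\<And>g. g \<in> carrier G \<Longrightarrow> word_length G T g \<le> K1 * word_length G S g"
      using word_length_change[OF G S T] by blast
    obtain K2 :: nat where K2: "\<And>g. g \<in> carrier G \<Longrightarrow> word_length G S g \<le> K2 * word_length G T g"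
      using word_length_change[OF G T S] by blast
    let ?D = "\<lambda>s t. dist (affine_map \<pi> b s v) (affine_map \<pi> b t v)"
    define e where "e = real K1 * a' + real K1 * (a' * c v + a') + a' * real K2 + (a' + c v)"
    have e: "real K1 * a' \<le> e" "real K1 * (a' * c v + a') \<le> e" "a' * real K2 \<le> e" "a' + c v \<le> e"
      using a'(1) c[OF one_closed one_closed, of v] by (simp_all add: e_def)
    show "qi_embedding (carrier G) (word_dist G T) dist (\<lambda>s. affine_map \<pi> b s v)"
    proof (rule qi_embeddingI[where a = e])
      fix s t assume st: "s \<in> carrier G" "t \<in> carrier G"
      then have g: "inv s \<otimes> t \<in> carrier G" by simp
      have 1: "word_dist G T s t \<le> real K1 * word_dist G S s t"
        "word_dist G S s t \<le> real K2 * word_dist G T s t"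
        unfolding word_dist_def using K1[OF g] K2[OF g] by (simp_all flip: of_nat_mult)
      have "real K1 * word_dist G S s t \<le> real K1 * (a' * ?D s t + a' * c v + a')"
        using low[OF st] by (intro mult_left_mono) auto
      also have "\<dots> = (real K1 * a') * ?D s t + real K1 * (a' * c v + a')" by (simp add: algebra_simps)
      also have "\<dots> \<le> e * ?D s t + e" using e by (intro add_mono mult_right_mono) auto
      finally show "word_dist G T s t \<le> e * ?D s t + e" using 1 by linarith
      have "?D s t \<le> a' * word_dist G S s t + (a' + c v)"
        using close'(2)[OF st, of v] upper'[OF st] by linarith
      also have "\<dots> \<le> a' * (real K2 * word_dist G T s t) + (a' + c v)"
        using 1 a'(1) by (intro add_right_mono mult_left_mono) auto
      also have "\<dots> = (a' * real K2) * word_dist G T s t + (a' + c v)" by simp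
      also have "\<dots> \<le> e * word_dist G T s t + e"
        using e by (intro add_mono mult_right_mono) (auto simp: word_dist_def)
      finally show "?D s t \<le> e * word_dist G T s t + e" .
    qed (simp add: word_dist_def)
  qed
qed

section \<open>Isometries of products\<close>

text \<open>Otherwise the index sets \<open>{1..N}\<close> are rewritten to \<open>{Suc 0..N}\<close>.\<close>

declare One_nat_def [simp del]

text \<open>With the inverse as a parameter the locale is symmetric in \<open>\<phi>\<close> and
  \<open>\<psi>\<close>, so each result can also be read for the inverse.\<close>

locale product_isometry =
  fixes N :: nat and X :: "nat \<Rightarrow> 'x set" and d :: "nat \<Rightarrow> 'x \<Rightarrow> 'x \<Rightarrow> real"
    and \<phi> \<psi> :: "(nat \<Rightarrow> 'x) \<Rightarrow> nat \<Rightarrow> 'x"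
  assumes metric: "i \<in> {1..N} \<Longrightarrow> Metric_space (X i) (d i)"
    and \<phi>_in [simp]: "x \<in> PiE {1..N} X \<Longrightarrow> \<phi> x \<in> PiE {1..N} X"
    and \<psi>_in [simp]: "x \<in> PiE {1..N} X \<Longrightarrow> \<psi> x \<in> PiE {1..N} X"
    and \<psi>\<phi> [simp]: "x \<in> PiE {1..N} X \<Longrightarrow> \<psi> (\<phi> x) = x"
    and \<phi>\<psi> [simp]: "x \<in> PiE {1..N} X \<Longrightarrow> \<phi> (\<psi> x) = x"
    and isometry: "x \<in> PiE {1..N} X \<Longrightarrow> y \<in> PiE {1..N} X \<Longrightarrow>
      prod_dist N d (\<phi> x) (\<phi> y) = prod_dist N d x y"
begin

abbreviation P :: "(nat \<Rightarrow> 'x) set" where "P \<equiv> PiE {1..N} X"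

abbreviation D :: "(nat \<Rightarrow> 'x) \<Rightarrow> (nat \<Rightarrow> 'x) \<Rightarrow> real" where "D \<equiv> prod_dist N d"

lemma isometry_inverse: "x \<in> P \<Longrightarrow> y \<in> P \<Longrightarrow> D (\<psi> x) (\<psi> y) = D x y"
  using isometry[of "\<psi> x" "\<psi> y"] by simp

lemma inverse: "product_isometry N X d \<psi> \<phi>"
  by (rule product_isometry.intro) (simp_all add: metric isometry_inverse)

lemma coord_in: "x \<in> P \<Longrightarrow> i \<in> {1..N} \<Longrightarrow> x i \<in> X i"
  by (rule PiE_mem)

lemma upd_in: "x \<in> P \<Longrightarrow> i \<in> {1..N} \<Longrightarrow> t \<in> X i \<Longrightarrow> x(i := t) \<in> P"
  by (simp add: PiE_iff extensional_def)

lemma d_nonneg: "i \<in> {1..N} \<Longrightarrow> 0 \<le> d i s t"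
  by (rule Metric_space.nonneg[OF metric])

lemma d_self: "i \<in> {1..N} \<Longrightarrow> x \<in> X i \<Longrightarrow> d i x x = 0"
  by (rule Metric_space.mdist_zero[OF metric])

lemma d_le_D: "i \<in> {1..N} \<Longrightarrow> d i (x i) (y i) \<le> D x y"
  unfolding prod_dist_def by (rule member_le_sum[of i _ "\<lambda>i. d i (x i) (y i)"]) (auto intro: d_nonneg)

section \<open>Metric betweenness, lines and boxes\<close>

definition between :: "(nat \<Rightarrow> 'x) \<Rightarrow> (nat \<Rightarrow> 'x) \<Rightarrow> (nat \<Rightarrow> 'x) \<Rightarrow> bool" where
  "between x z y \<longleftrightarrow> D x z + D z y = D x y"

lemma betweenI:
  assumes "\<And>i. i \<in> {1..N} \<Longrightarrow> d i (x i) (z i) + d i (z i) (y i) = d i (x i) (y i)"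
  shows "between x z y"
  unfolding between_def prod_dist_def sum.distrib[symmetric] using assms by (intro sum.cong) auto

text \<open>The triangle defects of the coordinates are nonnegative and add up to zero. So
  betweenness is invariant under isometries and also a coordinatewise condition.\<close>

lemma between_coord:
  assumes "x \<in> P" "y \<in> P" "z \<in> P" "between x z y" "i \<in> {1..N}"
  shows "d i (x i) (z i) + d i (z i) (y i) = d i (x i) (y i)"
proof -
  let ?f = "\<lambda>i. d i (x i) (z i) + d i (z i) (y i) - d i (x i) (y i)"
  have "?f j \<ge> 0" if "j \<in> {1..N}" for j
    using Metric_space.triangle[OF metric[OF that], of "x j" "z j" "y j"]
      assms(1-3)[THEN coord_in, OF that] by simp
  moreover have "sum ?f {1..N} = 0"
    using assms(4) by (simp add: between_def prod_dist_def sum.distrib sum_subtractf)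
  ultimately have "?f i = 0" using sum_nonneg_eq_0_iff[of "{1..N}" ?f] assms(5) by auto
  then show ?thesis by simp
qed

lemma between_image:
  "\<lbrakk>x \<in> P; y \<in> P; z \<in> P\<rbrakk> \<Longrightarrow> between (\<phi> x) (\<phi> z) (\<phi> y) \<longleftrightarrow> between x z y"
  by (simp add: between_def isometry)

lemma between_preimage:
  "\<lbrakk>x \<in> P; y \<in> P; z \<in> P\<rbrakk> \<Longrightarrow> between (\<psi> x) (\<psi> z) (\<psi> y) \<longleftrightarrow> between x z y"
  by (simp add: between_def isometry_inverse)

lemma between_const:
  assumes "x \<in> P" "y \<in> P" "z \<in> P" "between x z y" "i \<in> {1..N}" "x i = y i"
  shows "z i = x i"
proof -
  interpret Metric_space "X i" "d i" using metric assms(5) .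
  have xz: "x i \<in> X i" "z i \<in> X i" using coord_in assms(1,3,5) by blast+
  have "d i (x i) (z i) + d i (z i) (x i) = 0"
    using between_coord[OF assms(1-5)] assms(6) d_self[OF assms(5) xz(1)] by simp
  then have "d i (x i) (z i) = 0" using nonneg[of "x i" "z i"] nonneg[of "z i" "x i"] by linarith
  then show ?thesis using zero[OF xz] by simp
qed

definition parallel :: "nat \<Rightarrow> (nat \<Rightarrow> 'x) \<Rightarrow> (nat \<Rightarrow> 'x) \<Rightarrow> bool" where
  "parallel i x y \<longleftrightarrow> (\<forall>k\<in>{1..N} - {i}. x k = y k)"

lemma parallel_upd [simp]: "parallel i x (x(i := t))"
  by (simp add: parallel_def)

lemma parallel_sym: "parallel i x y \<Longrightarrow> parallel i y x"
  and parallel_trans: "parallel i x y \<Longrightarrow> parallel i y z \<Longrightarrow> parallel i x z"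
  by (simp_all add: parallel_def)

lemma D_parallel:
  assumes "parallel i x y" "x \<in> P" "i \<in> {1..N}"
  shows "D x y = d i (x i) (y i)"
proof -
  have "d k (x k) (y k) = 0" if "k \<in> {1..N} - {i}" for k
  proof -
    have "y k = x k" "k \<in> {1..N}" using assms(1) that by (simp_all add: parallel_def)
    then show ?thesis using d_self coord_in[OF assms(2)] by simp
  qed
  then show ?thesis unfolding prod_dist_def using assms(3) by (subst sum.remove[of _ i]) auto
qed

lemma between_parallel:
  assumes "x \<in> P" "y \<in> P" "z \<in> P" "between x z y" "parallel i x y"
  shows "parallel i x z"
  unfolding parallel_def
proof
  fix k assume k: "k \<in> {1..N} - {i}"
  then have "x k = y k" using assms(5) by (simp add: parallel_def)
  then show "x k = z k" using between_const[OF assms(1-4)] k by simp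
qed

text \<open>Images of lines parallel to a factor are convex, hence they are boxes.\<close>

lemma box:
  assumes x: "x \<in> P" and u: "u \<in> P" "parallel i x u" and v: "v \<in> P" "parallel i x v"
    and jk: "j \<in> {1..N}" "k \<in> {1..N}" "j \<noteq> k"
  defines "w \<equiv> (\<phi> x)(j := \<phi> u j, k := \<phi> v k)"
  shows "w \<in> P \<and> parallel i x (\<psi> w)"
proof -
  note c = coord_in[OF \<phi>_in[OF x]] coord_in[OF \<phi>_in[OF u(1)]] coord_in[OF \<phi>_in[OF v(1)]]
  \<comment> \<open>\<open>w1\<close> and \<open>w2\<close> lie between \<open>\<phi> x\<close> and
    the images of \<open>u\<close> and \<open>v\<close>, so they come from the line. The corner
    \<open>w\<close> lies between \<open>w1\<close> and \<open>w2\<close> and therefore comes from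
    it too.\<close>
  define w1 where "w1 = (\<phi> x)(j := \<phi> u j)"
  define w2 where "w2 = (\<phi> x)(k := \<phi> v k)"
  have in_P: "w1 \<in> P" "w2 \<in> P" "w \<in> P"
    using upd_in \<phi>_in[OF x] c jk by (simp_all add: w1_def w2_def w_def)
  have "between (\<phi> x) w1 (\<phi> u)" by (rule betweenI) (simp add: w1_def d_self c)
  then have "between x (\<psi> w1) u" using between_preimage[of "\<phi> x" "\<phi> u" w1] x u in_P by simp
  from between_parallel[OF x u(1) \<psi>_in[OF in_P(1)] this u(2)]
  have 1: "parallel i x (\<psi> w1)" .
  have "between (\<phi> x) w2 (\<phi> v)" by (rule betweenI) (simp add: w2_def d_self c)
  then have "between x (\<psi> w2) v" using between_preimage[of "\<phi> x" "\<phi> v" w2] x v in_P by simp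
  from between_parallel[OF x v(1) \<psi>_in[OF in_P(2)] this v(2)]
  have 2: "parallel i x (\<psi> w2)" .
  have "between w1 w w2"
    by (rule betweenI) (simp add: w1_def w2_def w_def d_self c jk)
  then have "between (\<psi> w1) (\<psi> w) (\<psi> w2)" using between_preimage in_P by blast
  from between_parallel[OF \<psi>_in[OF in_P(1)] \<psi>_in[OF in_P(2)] \<psi>_in[OF in_P(3)] this]
  have "parallel i (\<psi> w1) (\<psi> w)" using 1 2 parallel_sym parallel_trans by blast
  then show ?thesis using 1 in_P parallel_trans by blast
qed

abbreviation shadow :: "nat \<Rightarrow> nat \<Rightarrow> (nat \<Rightarrow> 'x) \<Rightarrow> 'x \<Rightarrow> 'x \<Rightarrow> real" where
  "shadow i j x s t \<equiv> d j (\<phi> (x(i := s)) j) (\<phi> (x(i := t)) j)"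

lemma shadow_le:
  assumes "x \<in> P" "i \<in> {1..N}" "j \<in> {1..N}" "s \<in> X i" "t \<in> X i"
  shows "shadow i j x s t \<le> d i s t"
proof -
  have "shadow i j x s t \<le> D (x(i := s)) (x(i := t))"
    using d_le_D[OF assms(3), of "\<phi> (x(i := s))" "\<phi> (x(i := t))"] isometry upd_in assms by simp
  also have "\<dots> = d i s t"
    using D_parallel[of i "x(i := s)" "x(i := t)"] upd_in assms by (simp add: parallel_def)
  finally show ?thesis .
qed

text \<open>By \<open>box\<close> the image of the line contains the square spanned by its
  projections to the coordinates \<open>j\<close> and \<open>k\<close>. Pulled back to the line, a
  copy of \<open>X i\<close>, this is a square as in \<open>small_squares\<close> with the shadows
  as \<open>D1\<close> and \<open>D2\<close>.\<close>

lemma one_large_shadow: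
  assumes sq: "small_squares (X i) (d i) R" and x: "x \<in> P"
    and ijk: "i \<in> {1..N}" "j \<in> {1..N}" "k \<in> {1..N}" "j \<noteq> k"
    and abcf: "a \<in> X i" "b \<in> X i" "c \<in> X i" "f \<in> X i"
  shows "shadow i j x a b \<le> R \<or> shadow i k x c f \<le> R"
proof -
  define w where "w z z' = (\<phi> x)(j := \<phi> (x(i := z)) j, k := \<phi> (x(i := z')) k)" for z z'
  have w: "w z z' \<in> P \<and> parallel i x (\<psi> (w z z'))" if "z \<in> X i" "z' \<in> X i" for z z'
    unfolding w_def using box[OF x _ _ _ _ ijk(2-4), of "x(i := z)" i "x(i := z')"] upd_in x ijk that
    by simp
  define e where "e z z' = \<psi> (w z z') i" for z z'
  have de: "d i (e z u) (e z' u') = shadow i j x z z' + shadow i k x u u'"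
    if z: "z \<in> X i" "u \<in> X i" "z' \<in> X i" "u' \<in> X i" for z u z' u'
  proof -
    have "d i (e z u) (e z' u') = D (\<psi> (w z u)) (\<psi> (w z' u'))"
      using D_parallel[of i "\<psi> (w z u)" "\<psi> (w z' u')"] w[OF z(1,2)] w[OF z(3,4)] ijk
      by (simp add: e_def parallel_def)
    also have "\<dots> = D (w z u) (w z' u')" using w z isometry_inverse by simp
    also have "\<dots> = (\<Sum>l\<in>{j, k}. d l (w z u l) (w z' u' l))"
      unfolding prod_dist_def
    proof (rule sum.mono_neutral_right)
      show "\<forall>l\<in>{1..N} - {j, k}. d l (w z u l) (w z' u' l) = 0"
        using d_self coord_in[OF \<phi>_in[OF x]] by (simp add: w_def)
    qed (use ijk in auto)
    also have "\<dots> = shadow i j x z z' + shadow i k x u u'" using ijk(4) by (simp add: w_def)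
    finally show ?thesis .
  qed
  have "e z u \<in> X i" if "z \<in> X i" "u \<in> X i" for z u
    using w[OF that] ijk coord_in[OF \<psi>_in] by (simp add: e_def)
  then show ?thesis
    using sq[unfolded small_squares_def, rule_format, of e "shadow i j x" "shadow i k x" a b c f]
      de abcf shadow_le[OF x ijk(1)] ijk d_nonneg by simp
qed

text \<open>Two opposite sides of a metric rectangle have equal length in each coordinate.\<close>

lemma shadow_base:
  assumes x: "x \<in> P" "y \<in> P" and ij: "i \<in> {1..N}" "j \<in> {1..N}" and st: "s \<in> X i" "t \<in> X i"
  shows "shadow i j x s t = shadow i j y s t"
proof -
  interpret Metric_space "X j" "d j" using metric ij(2) .
  define p q r u where "p = x(i := s)" "q = x(i := t)" "r = y(i := t)" "u = y(i := s)"
  note defs = this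
  have in_P: "p \<in> P" "q \<in> P" "r \<in> P" "u \<in> P" using upd_in[OF x(1) ij(1)] upd_in[OF x(2) ij(1)] st by (simp_all add: defs)
  \<comment> \<open>Each diagonal passes through either of the other two corners, which gives two
    expressions for its length in coordinate \<open>j\<close>. Adding the equations for the two
    diagonals cancels the sides from \<open>q\<close> to \<open>r\<close> and from \<open>p\<close>
    to \<open>u\<close>.\<close>
  have btw: "between p q r" "between p u r" "between q p u" "between q r u"
    by (rule betweenI; simp add: defs d_self st coord_in[OF x(1)] coord_in[OF x(2)])+
  let ?d = "\<lambda>p q. d j (\<phi> p j) (\<phi> q j)"
  have *: "?d x z + ?d z y = ?d x y" if "between x z y" "x \<in> P" "y \<in> P" "z \<in> P" for x y z
    using between_coord[of "\<phi> x" "\<phi> y" "\<phi> z" j] between_image[of x y z] that ij(2) by simp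
  have "?d p q + ?d q r = ?d p r" "?d p u + ?d u r = ?d p r"
    "?d q p + ?d p u = ?d q u" "?d q r + ?d r u = ?d q u"
    using * btw in_P by blast+
  then have "?d p q = ?d u r" using commute[of "\<phi> q j" "\<phi> p j"] commute[of "\<phi> r j" "\<phi> u j"] by simp
  then show ?thesis by (simp add: defs)
qed

text \<open>A qualitative form of factor \<open>i\<close> going to factor \<open>j\<close>. The line
  may vary with \<open>M\<close>, but by \<open>shadow_base\<close> displacements agree on all
  parallel lines.\<close>

definition carries :: "nat \<Rightarrow> nat \<Rightarrow> bool" where
  "carries i j \<longleftrightarrow> (\<forall>M. \<exists>x\<in>P. \<exists>t\<in>X i. d j (\<phi> x j) (\<phi> (x(i := t)) j) > M)"

text \<open>Otherwise the sum of the bounds for the coordinates of the image would bound the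
  distances in \<open>X i\<close>.\<close>

lemma carries_exists:
  assumes i: "i \<in> {1..N}" and unb: "\<And>M. \<exists>s\<in>X i. \<exists>t\<in>X i. d i s t > M" and "P \<noteq> {}"
  shows "\<exists>j\<in>{1..N}. carries i j"
proof (rule ccontr)
  assume "\<not> ?thesis"
  then have "\<forall>j\<in>{1..N}. \<exists>M. \<forall>x\<in>P. \<forall>t\<in>X i. d j (\<phi> x j) (\<phi> (x(i := t)) j) \<le> M"
    unfolding carries_def by (meson not_less)
  then obtain M where M: "\<And>j x t. \<lbrakk>j \<in> {1..N}; x \<in> P; t \<in> X i\<rbrakk> \<Longrightarrow>
      d j (\<phi> x j) (\<phi> (x(i := t)) j) \<le> M j"
    by metis
  obtain x where x: "x \<in> P" using \<open>P \<noteq> {}\<close> by blast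
  obtain s t where st: "s \<in> X i" "t \<in> X i" "d i s t > sum M {1..N}" using unb by blast
  have xs: "x(i := s) \<in> P" using upd_in x i st by blast
  have "d i s t = D (x(i := s)) (x(i := s, i := t))"
    using D_parallel[OF parallel_upd xs i, of t] by simp
  also have "\<dots> = D (\<phi> (x(i := s))) (\<phi> (x(i := s, i := t)))"
    using isometry[OF xs upd_in[OF xs i st(2)]] by simp
  also have "\<dots> \<le> sum M {1..N}"
    unfolding prod_dist_def using M[OF _ xs st(2)] by (intro sum_mono) auto
  finally show False using st(3) by simp
qed

interpretation inv: product_isometry N X d \<psi> \<phi> by (rule inverse)

text \<open>The corner \<open>u\<close> lies both on the image of the \<open>i\<close>-line through
  \<open>x\<close> and on the \<open>j\<close>-line through \<open>\<phi> x\<close>. Its distance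
  from \<open>\<phi> x\<close> can be measured along either, so \<open>\<psi>\<close> moves
  coordinate \<open>i\<close> by the same amount.\<close>

lemma carries_inverse:
  assumes "carries i j" "i \<in> {1..N}" "j \<in> {1..N}"
  shows "inv.carries j i"
  unfolding inv.carries_def
proof
  fix M
  obtain x t where x: "x \<in> P" "t \<in> X i" "d j (\<phi> x j) (\<phi> (x(i := t)) j) > M"
    using assms(1) unfolding carries_def by blast
  define y where "y = x(i := t)"
  have y: "y \<in> P" "parallel i x y" using upd_in[OF x(1) assms(2) x(2)] by (simp_all add: y_def)
  define u where "u = (\<phi> x)(j := \<phi> y j)"
  note c = coord_in[OF \<phi>_in[OF x(1)]] coord_in[OF \<phi>_in[OF y(1)]]
  have u: "u \<in> P" using upd_in[OF \<phi>_in[OF x(1)] assms(3)] c assms(3) by (simp add: u_def)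
  have "between (\<phi> x) u (\<phi> y)" by (rule betweenI) (simp add: u_def d_self c)
  then have "parallel i x (\<psi> u)"
    using between_preimage[of "\<phi> x" "\<phi> y" u] between_parallel[of x y "\<psi> u" i] x y u by simp
  then have "d i (x i) (\<psi> u i) = D x (\<psi> u)" using D_parallel x assms by simp
  also have "\<dots> = D (\<phi> x) u" using isometry[of x "\<psi> u"] x u by simp
  also have "\<dots> = d j (\<phi> x j) (\<phi> y j)"
    using D_parallel[of j "\<phi> x" u] x(1) assms(3) by (simp add: u_def)
  finally have "d i (\<psi> (\<phi> x) i) (\<psi> ((\<phi> x)(j := \<phi> y j)) i) > M" using x by (simp add: y_def u_def)
  then show "\<exists>x\<in>P. \<exists>t\<in>X j. d i (\<psi> x i) (\<psi> (x(j := t)) i) > M"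
    using \<phi>_in[OF x(1)] c(2)[OF assms(3)] by blast
qed

text \<open>From \<open>x\<close> to \<open>z\<close> only coordinate \<open>i\<close> changes, at a
  cost of \<open>d i (x i) (y i)\<close>. From \<open>z\<close> to \<open>y\<close> it is constant,
  and the image moves little in coordinate \<open>j\<close>: the \<open>j\<close>-line through
  \<open>\<phi> z\<close> pulls back to a set that is large in coordinate \<open>i\<close>, hence
  small in all others, while \<open>u\<close> pulls back to a point with the same coordinate
  \<open>i\<close> as \<open>z\<close>.\<close>

lemma carries_upper:
  fixes R :: real
  assumes "carries i j" and ij: "i \<in> {1..N}" "j \<in> {1..N}" and sq: "small_squares (X j) (d j) R"
    and x: "x \<in> P" and y: "y \<in> P"
  shows "d j (\<phi> x j) (\<phi> y j) \<le> d i (x i) (y i) + N * \<bar>R\<bar>"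
proof -
  interpret Metric_space "X j" "d j" using metric ij(2) .
  define z where "z = x(i := y i)"
  have z: "z \<in> P" using upd_in x y ij coord_in[of y i] by (simp add: z_def)
  define u where "u = (\<phi> z)(j := \<phi> y j)"
  note c = coord_in[OF \<phi>_in[OF x]] coord_in[OF \<phi>_in[OF y]] coord_in[OF \<phi>_in[OF z]]
  have u: "u \<in> P" using upd_in[OF \<phi>_in[OF z] ij(2)] c ij(2) by (simp add: u_def)
  have "between (\<phi> z) u (\<phi> y)" by (rule betweenI) (simp add: u_def d_self c)
  then have ui: "\<psi> u i = z i"
    using between_preimage[of "\<phi> z" "\<phi> y" u] between_const[of z y "\<psi> u" i] z y u ij
    by (simp add: z_def)
  obtain p s where ps: "p \<in> P" "s \<in> X j" "d i (\<psi> p i) (\<psi> (p(j := s)) i) > R"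
    using carries_inverse[OF assms(1) ij] unfolding inv.carries_def by blast
  \<comment> \<open>The large displacement is known on some \<open>j\<close>-line;
    \<open>shadow_base\<close> moves it to the one through \<open>\<phi> z\<close>.\<close>
  have "d i (\<psi> (p(j := p j)) i) (\<psi> (p(j := s)) i) = inv.shadow j i (\<phi> z) (p j) s"
    using inv.shadow_base[OF ps(1) \<phi>_in[OF z] ij(2,1) _ ps(2)] ps(1) ij(2) coord_in by blast
  then have large: "inv.shadow j i (\<phi> z) (p j) s > R" using ps(3) by simp
  have "d k (z k) (\<psi> u k) \<le> \<bar>R\<bar>" if k: "k \<in> {1..N}" for k
  proof (cases "k = i")
    case True
    then show ?thesis using ui d_self[OF ij(1)] coord_in[OF z ij(1)] by simp
  next
    case False
    then have "inv.shadow j k (\<phi> z) (\<phi> z j) (\<phi> y j) \<le> R"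
      using inv.one_large_shadow[OF sq \<phi>_in[OF z] ij(2,1) k] large ps ij(2) c coord_in[OF ps(1)]
      by (metis not_less)
    then show ?thesis using z by (simp add: u_def)
  qed
  then have "D z (\<psi> u) \<le> N * \<bar>R\<bar>"
    unfolding prod_dist_def using sum_bounded_above[of "{1..N}" _ "\<bar>R\<bar>"] by simp
  moreover have "D z (\<psi> u) = d j (\<phi> z j) (\<phi> y j)"
    using isometry[of z "\<psi> u"] D_parallel[of j "\<phi> z" u] z u ij(2) by (simp add: u_def)
  moreover have "d j (\<phi> x j) (\<phi> z j) \<le> d i (x i) (y i)"
    using d_le_D[OF ij(2), of "\<phi> x" "\<phi> z"] isometry[OF x z] D_parallel[of i x z] x ij(1)
    by (simp add: z_def)
  moreover have "d j (\<phi> x j) (\<phi> y j) \<le> d j (\<phi> x j) (\<phi> z j) + d j (\<phi> z j) (\<phi> y j)"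
    using triangle c ij(2) by blast
  ultimately show ?thesis by linarith
qed

text \<open>The lower bound is \<open>carries_upper\<close> for the inverse. The sum in the constant
  dominates both \<open>R j\<close> and \<open>R i\<close>.\<close>

lemma almost_permutes_factors:
  fixes R :: "nat \<Rightarrow> real"
  assumes i: "i \<in> {1..N}" and unb: "\<And>M. \<exists>s\<in>X i. \<exists>t\<in>X i. d i s t > M" and "P \<noteq> {}"
    and sq: "\<And>j. j \<in> {1..N} \<Longrightarrow> small_squares (X j) (d j) (R j)"
  shows "\<exists>j\<in>{1..N}. \<forall>x\<in>P. \<forall>y\<in>P.
    \<bar>d j (\<phi> x j) (\<phi> y j) - d i (x i) (y i)\<bar> \<le> N * (\<Sum>k\<in>{1..N}. \<bar>R k\<bar>)"
proof -
  obtain j where j: "j \<in> {1..N}" "carries i j" using carries_exists[OF i unb \<open>P \<noteq> {}\<close>] by blast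
  have R: "N * \<bar>R l\<bar> \<le> N * (\<Sum>k\<in>{1..N}. \<bar>R k\<bar>)" if "l \<in> {1..N}" for l
    using that by (intro mult_left_mono member_le_sum) auto
  have "\<bar>d j (\<phi> x j) (\<phi> y j) - d i (x i) (y i)\<bar> \<le> N * (\<Sum>k\<in>{1..N}. \<bar>R k\<bar>)"
    if "x \<in> P" "y \<in> P" for x y
    using carries_upper[OF j(2) i j(1) sq[OF j(1)] that] R[OF j(1)]
      product_isometry.carries_upper[OF inverse carries_inverse[OF j(2) i j(1)] j(1) i sq[OF i] \<phi>_in \<phi>_in, of x y] R[OF i] that
    by simp
  then show ?thesis using j(1) by blast
qed

end

section \<open>Groups acting on products of quasi-trees\<close>

lemma quasi_tree_nonempty: "quasi_tree TYPE('v) X d \<Longrightarrow> X \<noteq> {}"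
proof -
  assume "quasi_tree TYPE('v) X d"
  then obtain V :: "'v set" and E t A C where "quasi_tree_chart X d V E t A C"
    using quasi_tree_has_chart by blast
  then interpret quasi_tree_chart X d V E t A C .
  have "V \<noteq> {}" using tree by (simp add: simplicial_tree_def graph_connected_def)
  then show "X \<noteq> {}" using dense by blast
qed

locale QT_action = generated_group G S for G :: "('g, 'm) monoid_scheme" (structure) and S +
  fixes N :: nat and X :: "nat \<Rightarrow> 'x set" and d :: "nat \<Rightarrow> 'x \<Rightarrow> 'x \<Rightarrow> real"
    and \<phi> :: "'g \<Rightarrow> (nat \<Rightarrow> 'x) \<Rightarrow> nat \<Rightarrow> 'x" and vertices :: "'v itself" and a :: real
    and z :: "nat \<Rightarrow> 'x"
  assumes quasi_tree_factors: "i \<in> {1..N} \<Longrightarrow> quasi_tree vertices (X i) (d i)"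
    and isom: "isometric_action G (PiE {1..N} X) (prod_dist N d) \<phi>"
    and z: "z \<in> PiE {1..N} X"
    and a: "a \<ge> 1"
    and orbit_upper: "\<lbrakk>s \<in> carrier G; t \<in> carrier G\<rbrakk> \<Longrightarrow>
      prod_dist N d (\<phi> s z) (\<phi> t z) \<le> a * word_dist G S s t + a"
    and orbit_lower: "\<lbrakk>s \<in> carrier G; t \<in> carrier G\<rbrakk> \<Longrightarrow>
      word_dist G S s t \<le> a * prod_dist N d (\<phi> s z) (\<phi> t z) + a * a"
begin

abbreviation points where "points \<equiv> PiE {1..N} X"

lemma quasi_trees: "i \<in> {1..N} \<Longrightarrow> quasi_tree TYPE('v) (X i) (d i)"
  using quasi_tree_factors by (simp add: quasi_tree_def)

sublocale act: group_action G points \<phi>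
  using isom by (simp add: isometric_action_def)

lemma action_isometry: "s \<in> carrier G \<Longrightarrow> product_isometry N X d (\<phi> s) (\<phi> (inv s))"
proof (rule product_isometry.intro)
  fix x y assume s: "s \<in> carrier G"
  show "\<phi> s x \<in> points" "\<phi> (inv s) x \<in> points" "\<phi> (inv s) (\<phi> s x) = x" "\<phi> s (\<phi> (inv s) x) = x" if "x \<in> points"
    using act.element_image[OF s that refl] act.element_image[OF inv_closed[OF s] that refl]
      act.orbit_sym_aux[OF s that refl] act.orbit_sym_aux[OF inv_closed[OF s] that refl] s
    by simp_all
  show "prod_dist N d (\<phi> s x) (\<phi> s y) = prod_dist N d x y" if "x \<in> points" "y \<in> points"
    using isom s that by (simp add: isometric_action_def)
qed (use quasi_trees in \<open>simp add: quasi_tree_def\<close>)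

lemma in_P: "s \<in> carrier G \<Longrightarrow> x \<in> points \<Longrightarrow> \<phi> s x \<in> points"
  using act.element_image by blast

section \<open>The permutation of the unbounded factors\<close>

definition I :: "nat set" where
  "I = {i \<in> {1..N}. \<forall>M. \<exists>p\<in>X i. \<exists>q\<in>X i. d i p q > M}"

definition follows :: "real \<Rightarrow> 'g \<Rightarrow> nat \<Rightarrow> nat \<Rightarrow> bool" where
  "follows C s i j \<longleftrightarrow> j \<in> {1..N} \<and>
    (\<forall>x\<in>points. \<forall>y\<in>points. \<bar>d j (\<phi> s x j) (\<phi> s y j) - d i (x i) (y i)\<bar> \<le> C)"

lemma followsD:
  assumes "follows C s i j" "x \<in> points" "y \<in> points"
  shows "\<bar>d j (\<phi> s x j) (\<phi> s y j) - d i (x i) (y i)\<bar> \<le> C"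
  using assms unfolding follows_def by blast

text \<open>The constant comes from the factors alone and is thus chosen before \<open>s\<close>;
  this makes the action uniformly Lipschitz.\<close>

lemma follows_exists: "\<exists>C. \<forall>s\<in>carrier G. \<forall>i\<in>I. \<exists>j. follows C s i j"
proof -
  have "\<exists>R. \<forall>j\<in>{1..N}. small_squares (X j) (d j) (R j)"
    using quasi_tree_small_squares[OF quasi_trees] by (intro bchoice) blast
  then obtain R where R: "\<And>j. j \<in> {1..N} \<Longrightarrow> small_squares (X j) (d j) (R j)" by blast
  have "\<exists>j. follows (N * (\<Sum>k\<in>{1..N}. \<bar>R k\<bar>)) s i j" if s: "s \<in> carrier G" and i: "i \<in> I" for s i
  proof -
    interpret product_isometry N X d "\<phi> s" "\<phi> (inv s)" by (rule action_isometry[OF s])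
    have "i \<in> {1..N}" "\<And>M. \<exists>p\<in>X i. \<exists>q\<in>X i. d i p q > M" using i by (simp_all add: I_def)
    from almost_permutes_factors[OF this _ R] show ?thesis using z unfolding follows_def by blast
  qed
  then show ?thesis by blast
qed

lemma follows_in_I:
  assumes "follows C s i j" "i \<in> I" and s: "s \<in> carrier G"
  shows "j \<in> I"
  unfolding I_def
proof (intro CollectI conjI allI)
  interpret product_isometry N X d "\<phi> s" "\<phi> (inv s)" by (rule action_isometry[OF s])
  show j: "j \<in> {1..N}" using assms(1) by (simp add: follows_def)
  fix M
  have i: "i \<in> {1..N}" using assms(2) by (simp add: I_def)
  obtain p q where pq: "p \<in> X i" "q \<in> X i" "d i p q > M + C"
    using assms(2) unfolding I_def by blast
  note upd = upd_in[OF z i pq(1)] upd_in[OF z i pq(2)]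
  have "\<bar>d j (\<phi> s (z(i := p)) j) (\<phi> s (z(i := q)) j) - d i p q\<bar> \<le> C"
    using followsD[OF assms(1) upd] by simp
  then have "d j (\<phi> s (z(i := p)) j) (\<phi> s (z(i := q)) j) > M" using pq(3) by linarith
  then show "\<exists>p\<in>X j. \<exists>q\<in>X j. d j p q > M"
    using coord_in[OF in_P[OF s upd(1)] j] coord_in[OF in_P[OF s upd(2)] j] by blast
qed

text \<open>Two points far apart in coordinate \<open>j\<close> and equal in the others would have
  preimages both far apart and close in factor \<open>i\<close>. Allowing two constants makes
  composites comparable, whose errors add up.\<close>

lemma follows_unique:
  assumes "follows C s i j" "follows C' s i k" "i \<in> I" and s: "s \<in> carrier G"
  shows "j = k"
proof (rule ccontr)
  assume neq: "j \<noteq> k"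
  interpret product_isometry N X d "\<phi> s" "\<phi> (inv s)" by (rule action_isometry[OF s])
  have jk: "j \<in> {1..N}" "k \<in> {1..N}" using assms(1,2) by (simp_all add: follows_def)
  have "j \<in> I" using follows_in_I assms by blast
  then obtain p q where pq: "p \<in> X j" "q \<in> X j" "d j p q > C + C'" unfolding I_def by blast
  define x where "x p = z(j := p)" for p
  have x: "x p \<in> points" "x q \<in> points" using upd_in[OF z jk(1)] pq by (simp_all add: x_def)
  define u where "u p = \<phi> (inv s) (x p)" for p
  have u: "u p \<in> points" "u q \<in> points" "\<phi> s (u p) = x p" "\<phi> s (u q) = x q"
    using x by (simp_all add: u_def)
  have "\<bar>d j (x p j) (x q j) - d i (u p i) (u q i)\<bar> \<le> C"
    using followsD[OF assms(1) u(1,2)] u(3,4) by simp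
  moreover have "\<bar>d k (x p k) (x q k) - d i (u p i) (u q i)\<bar> \<le> C'"
    using followsD[OF assms(2) u(1,2)] u(3,4) by simp
  moreover have "d k (x p k) (x q k) = 0" "d j (x p j) (x q j) = d j p q"
    using neq d_self[OF jk(2) coord_in[OF z jk(2)]] by (simp_all add: x_def)
  ultimately show False using pq(3) by linarith
qed

lemma follows_mult:
  assumes "follows C t i j" "follows C' s j k" "s \<in> carrier G" "t \<in> carrier G"
  shows "follows (C + C') (s \<otimes> t) i k"
proof -
  have "\<bar>d k (\<phi> (s \<otimes> t) x k) (\<phi> (s \<otimes> t) y k) - d i (x i) (y i)\<bar> \<le> C + C'"
    if xy: "x \<in> points" "y \<in> points" for x y
  proof -
    have "\<bar>d j (\<phi> t x j) (\<phi> t y j) - d i (x i) (y i)\<bar> \<le> C"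
      by (rule followsD[OF assms(1) xy])
    moreover have "\<bar>d k (\<phi> s (\<phi> t x) k) (\<phi> s (\<phi> t y) k) - d j (\<phi> t x j) (\<phi> t y j)\<bar> \<le> C'"
      by (rule followsD[OF assms(2) in_P[OF assms(4) xy(1)] in_P[OF assms(4) xy(2)]])
    moreover have "\<phi> (s \<otimes> t) x = \<phi> s (\<phi> t x)" "\<phi> (s \<otimes> t) y = \<phi> s (\<phi> t y)"
      using act.composition_rule assms(3,4) xy by auto
    ultimately show ?thesis by simp
  qed
  then show ?thesis using assms(2) by (simp add: follows_def)
qed

lemma follows_one: "i \<in> I \<Longrightarrow> follows 0 \<one> i i"
proof -
  have "\<phi> \<one> x = x" if "x \<in> points" for x using act.id_eq_one that by (metis restrict_apply')
  then show "i \<in> I \<Longrightarrow> follows 0 \<one> i i" by (simp add: follows_def I_def)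
qed

lemma bounded_factors: "\<exists>M\<ge>0. \<forall>i\<in>{1..N} - I. \<forall>p\<in>X i. \<forall>q\<in>X i. d i p q \<le> M"
proof -
  have "\<forall>i\<in>{1..N} - I. \<exists>M. \<forall>p\<in>X i. \<forall>q\<in>X i. d i p q \<le> M"
    unfolding I_def by (auto simp: not_less)
  then obtain M where M: "\<And>i p q. \<lbrakk>i \<in> {1..N} - I; p \<in> X i; q \<in> X i\<rbrakk> \<Longrightarrow> d i p q \<le> M i"
    by (metis (lifting))
  let ?M = "\<Sum>i\<in>{1..N} - I. \<bar>M i\<bar>"
  have "d i p q \<le> ?M" if "i \<in> {1..N} - I" "p \<in> X i" "q \<in> X i" for i p q
  proof -
    have "\<bar>M i\<bar> \<le> ?M" using that(1) by (intro member_le_sum) auto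
    then show ?thesis using M[OF that] by linarith
  qed
  moreover have "?M \<ge> 0" by (simp add: sum_nonneg)
  ultimately show ?thesis by blast
qed

section \<open>Trees on the group from the coordinates of the orbit\<close>

lemma coordinate_ancestor_systems:
  obtains A c where "c \<ge> 1" "\<And>i. i \<in> {1..N} \<Longrightarrow> ancestor_system (carrier G) \<one> (A i)"
    "\<And>i g h. \<lbrakk>i \<in> {1..N}; g \<in> carrier G; h \<in> carrier G\<rbrakk> \<Longrightarrow>
      real (card (symdiff (A i g) (A i h))) \<le> c * d i (\<phi> g z i) (\<phi> h z i) + c"
    "\<And>i g h. \<lbrakk>i \<in> {1..N}; g \<in> carrier G; h \<in> carrier G\<rbrakk> \<Longrightarrow>
      d i (\<phi> g z i) (\<phi> h z i) \<le> c * real (card (symdiff (A i g) (A i h))) + c"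
proof -
  interpret product_isometry N X d "\<phi> \<one>" "\<phi> (inv \<one>)" by (rule action_isometry) simp
  define good where "good i A c \<longleftrightarrow> c \<ge> 1 \<and> ancestor_system (carrier G) \<one> A \<and>
    (\<forall>g\<in>carrier G. \<forall>h\<in>carrier G.
      real (card (symdiff (A g) (A h))) \<le> c * d i (\<phi> g z i) (\<phi> h z i) + c \<and>
      d i (\<phi> g z i) (\<phi> h z i) \<le> c * real (card (symdiff (A g) (A h))) + c)" for i A c
  have "\<exists>A c. good i A c" if i: "i \<in> {1..N}" for i
  proof -
    have step: "d i (\<phi> u z i) (\<phi> v z i) \<le> 2 * a"
      if "u \<in> carrier G" "v \<in> carrier G" "word_dist G S u v \<le> 1" for u v
    proof -
      have "d i (\<phi> u z i) (\<phi> v z i) \<le> a * word_dist G S u v + a"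
        using d_le_D[OF i] orbit_upper[OF that(1,2)] order_trans by blast
      also have "\<dots> \<le> a * 1 + a" using that(3) a by (intro add_right_mono mult_left_mono) auto
      finally show ?thesis by simp
    qed
    have chain: "(\<lambda>u v. u \<in> carrier G \<and> v \<in> carrier G \<and> d i (\<phi> u z i) (\<phi> v z i) \<le> 2 * a)\<^sup>*\<^sup>* \<one> g"
      if "g \<in> carrier G" for g
      by (rule rtranclp_mono[THEN predicate2D, OF _ word_chain[OF that]]) (use step in auto)
    have "(\<lambda>g. \<phi> g z i) \<in> carrier G \<rightarrow> X i" using coord_in[OF in_P[OF _ z] i] by blast
    from ancestor_system_of_quasi_tree[OF quasi_trees[OF i] this one_closed chain]
    show ?thesis unfolding good_def by (metis (lifting))
  qed
  then obtain A c where Ac: "\<And>i. i \<in> {1..N} \<Longrightarrow> good i (A i) (c i)" by metis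
  define C where "C = 1 + (\<Sum>i\<in>{1..N}. \<bar>c i\<bar>)"
  have c: "c i \<le> C" if "i \<in> {1..N}" for i
  proof -
    have "\<bar>c i\<bar> \<le> (\<Sum>i\<in>{1..N}. \<bar>c i\<bar>)" using that by (intro member_le_sum) auto
    then show ?thesis by (simp add: C_def)
  qed
  have mono: "c i * x + c i \<le> C * x + C" if "i \<in> {1..N}" "x \<ge> 0" for i x
    using c[OF that(1)] that(2) by (intro add_mono mult_right_mono) auto
  show thesis
  proof (rule that[of C A])
    show "C \<ge> 1" by (simp add: C_def sum_nonneg)
    fix i g h assume i: "i \<in> {1..N}"
    show "ancestor_system (carrier G) \<one> (A i)" using Ac[OF i] by (simp add: good_def)
    assume gh: "g \<in> carrier G" "h \<in> carrier G"
    show "real (card (symdiff (A i g) (A i h))) \<le> C * d i (\<phi> g z i) (\<phi> h z i) + C"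
      using Ac[OF i] gh mono[OF i d_nonneg[OF i]] unfolding good_def by (meson order_trans)
    show "d i (\<phi> g z i) (\<phi> h z i) \<le> C * real (card (symdiff (A i g) (A i h))) + C"
      using Ac[OF i] gh mono[OF i of_nat_0_le_iff] unfolding good_def by (meson order_trans)
  qed
qed

lemma affine_action_exists:
  "\<exists>(\<pi> :: 'g \<Rightarrow> ell1 \<Rightarrow>\<^sub>L ell1) b. affine_action G \<pi> b \<and> uniformly_lipschitz G \<pi> \<and>
    proper_action G (affine_map \<pi> b) \<and> qi_embedded_orbits G (affine_map \<pi> b)"
proof -
  interpret id: product_isometry N X d "\<phi> \<one>" "\<phi> (inv \<one>)" by (rule action_isometry) simp
  have I_sub: "I \<subseteq> {1..N}" and fin: "finite I" by (auto simp: I_def)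
  obtain C where C: "\<And>s i. \<lbrakk>s \<in> carrier G; i \<in> I\<rbrakk> \<Longrightarrow> \<exists>j. follows C s i j"
    using follows_exists by blast
  define \<sigma> where "\<sigma> s i = (SOME j. follows C s i j)" for s i
  have \<sigma>: "follows C s i (\<sigma> s i)" if "s \<in> carrier G" "i \<in> I" for s i
    unfolding \<sigma>_def using C[OF that] by (rule someI_ex)
  have \<sigma>_in: "\<sigma> s i \<in> I" if "s \<in> carrier G" "i \<in> I" for s i
    using follows_in_I[OF \<sigma>] that by blast
  have \<sigma>_one: "\<sigma> \<one> i = i" if "i \<in> I" for i
    using follows_unique[OF \<sigma> follows_one] that by blast
  \<comment> \<open>The left side is chosen with error \<open>C\<close>, the right side follows with
    error \<open>C + C\<close>; uniqueness across constants identifies them.\<close>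
  have \<sigma>_mult: "\<sigma> (s \<otimes> t) i = \<sigma> s (\<sigma> t i)" if "s \<in> carrier G" "t \<in> carrier G" "i \<in> I" for s t i
    using follows_unique[OF \<sigma> follows_mult[OF \<sigma>[OF that(2,3)] \<sigma>[OF that(1) \<sigma>_in[OF that(2,3)]]]] that
    by simp
  have bij: "bij_betw (\<sigma> s) I I" if s: "s \<in> carrier G" for s
    using \<sigma>_mult[of s "inv s"] \<sigma>_mult[of "inv s" s] \<sigma>_one \<sigma>_in s
    by (intro bij_betwI[where g = "\<sigma> (inv s)"]) auto
  obtain A c where c: "c \<ge> 1" and A: "\<And>i. i \<in> {1..N} \<Longrightarrow> ancestor_system (carrier G) \<one> (A i)"
    and card_le: "\<And>i g h. \<lbrakk>i \<in> {1..N}; g \<in> carrier G; h \<in> carrier G\<rbrakk> \<Longrightarrow>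
      real (card (symdiff (A i g) (A i h))) \<le> c * d i (\<phi> g z i) (\<phi> h z i) + c"
    and card_ge: "\<And>i g h. \<lbrakk>i \<in> {1..N}; g \<in> carrier G; h \<in> carrier G\<rbrakk> \<Longrightarrow>
      d i (\<phi> g z i) (\<phi> h z i) \<le> c * real (card (symdiff (A i g) (A i h))) + c"
    using coordinate_ancestor_systems by metis
  \<comment> \<open>The ends of an edge have distance at most \<open>2 * c\<close> in factor
    \<open>i\<close>. Translation adds at most \<open>C\<close>, and \<open>card_le\<close> converts
    the result back to the tree of factor \<open>\<sigma> s i\<close>.\<close>
  have bound: "real (card (symdiff (A (\<sigma> s i) (s \<otimes> g)) (A (\<sigma> s i) (s \<otimes> h)))) \<le> c * (2 * c + C) + c"
    if s: "s \<in> carrier G" and i: "i \<in> I" and gh: "g \<in> carrier G" "h \<in> carrier G"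
      and 1: "card (symdiff (A i g) (A i h)) = 1" for s i g h
  proof -
    let ?j = "\<sigma> s i"
    have j: "?j \<in> {1..N}" using \<sigma>_in[OF s i] I_sub by blast
    have "d i (\<phi> g z i) (\<phi> h z i) \<le> 2 * c" using card_ge[OF _ gh, of i] i I_sub 1 by auto
    moreover have "\<bar>d ?j (\<phi> s (\<phi> g z) ?j) (\<phi> s (\<phi> h z) ?j) - d i (\<phi> g z i) (\<phi> h z i)\<bar> \<le> C"
      by (rule followsD[OF \<sigma>[OF s i] in_P[OF gh(1) z] in_P[OF gh(2) z]])
    ultimately have "d ?j (\<phi> (s \<otimes> g) z ?j) (\<phi> (s \<otimes> h) z ?j) \<le> 2 * c + C"
      using act.composition_rule[OF z s gh(1)] act.composition_rule[OF z s gh(2)] by simp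
    then have "c * d ?j (\<phi> (s \<otimes> g) z ?j) (\<phi> (s \<otimes> h) z ?j) \<le> c * (2 * c + C)"
      using c by (intro mult_left_mono) auto
    then show ?thesis using card_le[OF j, of "s \<otimes> g" "s \<otimes> h"] s gh by simp
  qed
  obtain \<pi> :: "'g \<Rightarrow> ell1 \<Rightarrow>\<^sub>L ell1" and b where action: "affine_action G \<pi> b" "uniformly_lipschitz G \<pi>"
    and dist_b: "\<And>s t. \<lbrakk>s \<in> carrier G; t \<in> carrier G\<rbrakk> \<Longrightarrow>
      dist (b s) (b t) = (\<Sum>i\<in>I. real (card (symdiff (A i s) (A i t))))"
    using affine_action_of_ancestor_systems[OF is_group countable_carrier fin A bij \<sigma>_one \<sigma>_mult bound] I_sub
    by blast
  obtain M where M: "M \<ge> 0" "\<And>i p q. \<lbrakk>i \<in> {1..N} - I; p \<in> X i; q \<in> X i\<rbrakk> \<Longrightarrow> d i p q \<le> M"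
    using bounded_factors by blast
  let ?D = "\<lambda>s t. prod_dist N d (\<phi> s z) (\<phi> t z)"
  have upper: "dist (b s) (b t) \<le> c * ?D s t + N * c" if st: "s \<in> carrier G" "t \<in> carrier G" for s t
  proof -
    have "dist (b s) (b t) \<le> (\<Sum>i\<in>I. c * d i (\<phi> s z i) (\<phi> t z i) + c)"
      unfolding dist_b[OF st] using card_le st I_sub by (intro sum_mono) blast
    also have "\<dots> \<le> (\<Sum>i\<in>{1..N}. c * d i (\<phi> s z i) (\<phi> t z i) + c)"
      using I_sub c id.d_nonneg by (intro sum_mono2) auto
    also have "\<dots> = c * ?D s t + N * c" by (simp add: prod_dist_def sum.distrib sum_distrib_left)
    finally show ?thesis .
  qed
  \<comment> \<open>Factors outside \<open>I\<close> have no tree in the sum defining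
    \<open>b\<close>; each contributes at most \<open>M\<close>.\<close>
  have lower: "?D s t \<le> c * dist (b s) (b t) + N * (c + M)" if st: "s \<in> carrier G" "t \<in> carrier G" for s t
  proof -
    let ?f = "\<lambda>i. if i \<in> I then c * real (card (symdiff (A i s) (A i t))) else 0"
    have "d i (\<phi> s z i) (\<phi> t z i) \<le> ?f i + (c + M)" if i: "i \<in> {1..N}" for i
      using card_ge[OF i st] M c id.coord_in[OF in_P[OF st(1) z] i] id.coord_in[OF in_P[OF st(2) z] i] i
      by (cases "i \<in> I") fastforce+
    then have "?D s t \<le> (\<Sum>i\<in>{1..N}. ?f i + (c + M))" unfolding prod_dist_def by (intro sum_mono)
    also have "\<dots> = (\<Sum>i\<in>{1..N}. ?f i) + N * (c + M)" by (simp add: sum.distrib)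
    also have "(\<Sum>i\<in>{1..N}. ?f i) = (\<Sum>i\<in>I. c * real (card (symdiff (A i s) (A i t))))"
      using I_sub by (simp add: sum.inter_restrict[symmetric] Int_absorb1)
    finally show ?thesis by (simp add: dist_b[OF st] sum_distrib_left)
  qed
  define e where "e = c * a + a * c + (c * a + N * c) + (a * (N * (c + M)) + a * a)"
  have e: "c * a \<le> e" "a * c \<le> e" "c * a + N * c \<le> e" "a * (N * (c + M)) + a * a \<le> e"
    using a c M(1) by (simp_all add: e_def)
  have up: "dist (b s) (b t) \<le> e * word_dist G S s t + e" if st: "s \<in> carrier G" "t \<in> carrier G" for s t
  proof -
    have "c * ?D s t \<le> c * (a * word_dist G S s t + a)"
      using orbit_upper[OF st] c by (intro mult_left_mono) auto
    then have "dist (b s) (b t) \<le> (c * a) * word_dist G S s t + (c * a + N * c)"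
      using upper[OF st] by (simp add: algebra_simps)
    also have "\<dots> \<le> e * word_dist G S s t + e"
      using e by (intro add_mono mult_right_mono) (auto simp: word_dist_def)
    finally show ?thesis .
  qed
  have low: "word_dist G S s t \<le> e * dist (b s) (b t) + e" if st: "s \<in> carrier G" "t \<in> carrier G" for s t
  proof -
    have "a * ?D s t \<le> a * (c * dist (b s) (b t) + N * (c + M))"
      using lower[OF st] a by (intro mult_left_mono) auto
    then have "word_dist G S s t \<le> (a * c) * dist (b s) (b t) + (a * (N * (c + M)) + a * a)"
      using orbit_lower[OF st] by (simp add: algebra_simps)
    also have "\<dots> \<le> e * dist (b s) (b t) + e" using e by (intro add_mono mult_right_mono) auto
    finally show ?thesis .
  qed
  show ?thesis using action orbits_of_qi_cocycle[OF is_group gen action(2) low up] by blast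
qed

end

theorem corollary1p3:
  fixes G :: "('g, 'm) monoid_scheme"
  assumes "group G" and "finitely_generated G"
    and "property_QT TYPE('x) TYPE('v) G"
  shows "\<exists>(\<pi> :: 'g \<Rightarrow> ell1 \<Rightarrow>\<^sub>L ell1) b.
           affine_action G \<pi> b \<and>
           uniformly_lipschitz G \<pi> \<and>
           proper_action G (affine_map \<pi> b) \<and>
           qi_embedded_orbits G (affine_map \<pi> b)"
proof -
  obtain S N and X :: "nat \<Rightarrow> 'x set" and d \<phi> where QT: "finite_generating_set G S"
    "\<forall>i\<in>{1..N}. quasi_tree TYPE('v) (X i) (d i)"
    "isometric_action G (PiE {1..N} X) (prod_dist N d) \<phi>"
    "\<forall>z\<in>PiE {1..N} X. qi_embedding (carrier G) (word_dist G S) (prod_dist N d) (\<lambda>s. \<phi> s z)"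
    using assms(3) unfolding property_QT_def by blast
  have "PiE {1..N} X \<noteq> {}" using quasi_tree_nonempty QT(2) by (auto simp: PiE_eq_empty_iff)
  then obtain z where z: "z \<in> PiE {1..N} X" by blast
  obtain a where a: "a \<ge> 1" "\<And>s t. \<lbrakk>s \<in> carrier G; t \<in> carrier G\<rbrakk> \<Longrightarrow>
      (1 / a) * word_dist G S s t - a \<le> prod_dist N d (\<phi> s z) (\<phi> t z) \<and>
      prod_dist N d (\<phi> s z) (\<phi> t z) \<le> a * word_dist G S s t + a"
    using QT(4) z unfolding qi_embedding_def by blast
  have "word_dist G S s t \<le> a * prod_dist N d (\<phi> s z) (\<phi> t z) + a * a"
    if "s \<in> carrier G" "t \<in> carrier G" for s t
    using a(2)[OF that] a(1) by (simp add: field_simps)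
  then have "QT_action G S N X d \<phi> TYPE('v) a z"
    using assms(1) QT z a
    by (simp add: QT_action_def QT_action_axioms_def generated_group_def generated_group_axioms_def)
  then show ?thesis by (rule QT_action.affine_action_exists)
qed

end
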